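(* Let $r\in\mathbb{N}$, let $2\le m_1\le\cdots\le m_r$ be integers, let $\Omega\subset(\prod_{l=1}^r\mathcal{I}_l)^{\mathbb{N}}$ (with $\mathcal{I}_l=\{0,\dots,m_l-1\}$) be a non-empty subshift, and let $(X_\Omega,\sigma,d)$ be the associated sponge system. Assume that for every $1\le i\le r-1$ there exists a sequence $(P_N^{(r-i+1)})_{N\in\mathbb N}$ of positive real numbers such that $$\lim_{N\to\infty}\left(\frac{|(\tau_i|_N)^{-1}(\mathbf v^{(r-i)})|}{P_N^{(r-i+1)}}\right)^{1/N}=1$$ uniformly over $\mathbf v^{(r-i)}\in\pi_{r-i}(\Omega)|_N$. Then $$\mathrm{mdim}_{\mathrm H}(X_\Omega,\sigma,d)=\mathrm{mdim}_{\mathrm M}(X_\Omega,\sigma,d).$$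
   Context: $\mathbb{N}$ is the set of positive integers; $|U|$ is the cardinality of a set $U$. **Subshifts and projections.** $\sigma$ denotes the one-sided shift on $(\prod_{l=1}^i\mathcal I_l)^{\mathbb N}$ for each $1\le i\le r$; a subshift is a closed subset $\Omega$ with $\sigma(\Omega)\subset\Omega$. We identify $(\prod_{l=1}^i\mathcal I_l)^{\mathbb N}$ with $\prod_{l=1}^i\mathcal I_l^{\mathbb N}$. For $1\le i\le r-1$, $\pi_i:(\prod_{l=1}^r\mathcal I_l)^{\mathbb N}\to(\prod_{l=1}^i\mathcal I_l)^{\mathbb N}$ applies to each term of the sequence the projection $(x_1,\dots,x_r)\mapsto(x_1,\dots,x_i)$; $\pi_r$ is the identity on $\Omega$. For $N\in\mathbb N$, $\pi_i(\Omega)|_N\subset\prod_{l=1}^i\mathcal I_l^N$ is the image of $\pi_i(\Omega)$ under restriction of sequences to their first $N$ terms. For $1\le i\le r-1$, $\tau_i:\pi_{r-i+1}(\Omega)\to\pi_{r-i}(\Omega)$ is the factor map $(\mathbf x_1,\dots,\mathbf x_{r-i+1})\mapsto(\mathbf x_1,\dots,\mathbf x_{r-i})$, and $\tau_i|_N:\pi_{r-i+1}(\Omega)|_N\to\pi_{r-i}(\Omega)|_N$ is the corresponding natural projection $(\mathbf u_1,\dots,\mathbf u_{r-i+1})\mapsto(\mathbf u_1,\dots,\mathbf u_{r-i})$, $\mathbf u_l\in\mathcal I_l^N$. **Sponge system.** On $([0,1]^{\mathbb N})^r$ use the metric $d((\mathbf x_1,\dots,\mathbf x_r),(\mathbf y_1,\dots,\mathbf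 y_r))=\sum_{k=1}^\infty2^{-k}\max_{1\le l\le r}|\mathbf x_{k,l}-\mathbf y_{k,l}|$, where $\mathbf x_l=(\mathbf x_{k,l})_{k\in\mathbb N}$, $\mathbf y_l=(\mathbf y_{k,l})_{k\in\mathbb N}$, and the shift $\sigma((\mathbf x_{k,1})_k,\dots,(\mathbf x_{k,r})_k)=((\mathbf x_{k+1,1})_k,\dots,(\mathbf x_{k+1,r})_k)$. The sponge system is $$X_\Omega=\left\{\left(\sum_{k=1}^\infty\frac{\mathbf x_{k,1}}{m_1^k},\dots,\sum_{k=1}^\infty\frac{\mathbf x_{k,r}}{m_r^k}\right)\in([0,1]^{\mathbb N})^r:\ (\mathbf x_{k,1},\dots,\mathbf x_{k,r})\in\Omega\ \ \forall k\in\mathbb N\right\},$$ where here each $\mathbf x_{k,l}\in\mathcal I_l^{\mathbb N}\subset\ell^\infty$ and the sums are taken in $\ell^\infty$. It is a shift-invariant compact set. **Dimensions.** For a compact metric space $(X,d)$ and $\varepsilon>0$, $\#(X,d,\varepsilon)$ is the minimal $n\ge1$ such that $X$ has an open cover $\{U_1,\dots,U_n\}$ with $\mathrm{Diam}\,U_i<\varepsilon$ for all $i$. For $s\ge0$ let $\mathcal H^s_\varepsilon(X,d)=\inf\{\sum_{i=1}^\infty(\mathrm{Diam}\,E_i)^s: X=\bigcup_{i=1}^\infty E_i,\ \mathrm{Diam}\,E_i<\varepsilon\ \forall i\}$, with conventions $(\mathrm{Diam}\,\emptyset)^s=0$ for all $s\ge0$ and $0^0=1$, and $\dim_{\mathrm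 H}(X,d,\varepsilon)=\sup\{s\ge0:\mathcal H^s_\varepsilon(X,d)\ge1\}$. For a continuous self-map $T$ of a compact metric space $(X,d)$ let $d_N(x,y)=\max_{0\le n<N}d(T^nx,T^ny)$. The upper (lower) metric mean dimension is the $\limsup_{\varepsilon\to0}$ ($\liminf_{\varepsilon\to0}$) of $\lim_{N\to\infty}\frac{\log\#(X,d_N,\varepsilon)}{N\log(1/\varepsilon)}$; if they coincide, the common value is $\mathrm{mdim}_{\mathrm M}(X,T,d)$. The upper (lower) mean Hausdorff dimension is $\lim_{\varepsilon\to0}\limsup_{N\to\infty}\frac{\dim_{\mathrm H}(X,d_N,\varepsilon)}N$ (resp. with $\liminf_{N\to\infty}$); if they coincide, the common value is $\mathrm{mdim}_{\mathrm H}(X,T,d)$. The equality in the claim includes the assertion that the upper and lower versions coincide. *)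

theory Defs
  imports "HOL-Analysis.Analysis"
begin

section \<open>Scale-dependent dimensions of a metric space\<close>

definition diam_on :: "('a \<Rightarrow> 'a \<Rightarrow> real) \<Rightarrow> 'a set \<Rightarrow> real" where
  "diam_on d E = (if E = {} then 0 else SUP (x, y)\<in>E \<times> E. d x y)"

definition cover_num :: "'a set \<Rightarrow> ('a \<Rightarrow> 'a \<Rightarrow> real) \<Rightarrow> real \<Rightarrow> nat" where
  "cover_num X d \<epsilon> = (LEAST n. 1 \<le> n \<and> (\<exists>U :: nat \<Rightarrow> 'a set.
     (\<forall>i<n. openin (Metric_space.mtopology X d) (U i) \<and> diam_on d (U i) < \<epsilon>) \<and> X = (\<Union>i<n. U i)))"

(* powr has 0 powr 0 = 0 in the library, hence the separate case for the convention 0^0 = 1. *)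
definition diam_pow :: "('a \<Rightarrow> 'a \<Rightarrow> real) \<Rightarrow> real \<Rightarrow> 'a set \<Rightarrow> real" where
  "diam_pow d s E =
     (if E = {} then 0 else if s = 0 then 1 else diam_on d E powr s)"

definition hausdorff_sum :: "real \<Rightarrow> 'a set \<Rightarrow> ('a \<Rightarrow> 'a \<Rightarrow> real) \<Rightarrow> real \<Rightarrow> ennreal" where
  "hausdorff_sum s X d \<epsilon> =
     (INF E \<in> {E :: nat \<Rightarrow> 'a set. X = (\<Union>i. E i) \<and> (\<forall>i. diam_on d (E i) < \<epsilon>)}.
        \<Sum>i. ennreal (diam_pow d s (E i)))"

definition dim_H :: "'a set \<Rightarrow> ('a \<Rightarrow> 'a \<Rightarrow> real) \<Rightarrow> real \<Rightarrow> ereal" where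
  "dim_H X d \<epsilon> = (SUP s \<in> {s. 0 \<le> s \<and> 1 \<le> hausdorff_sum s X d \<epsilon>}. ereal s)"


section \<open>Mean dimensions of a dynamical system\<close>

(* Only meant for N \<ge> 1; the mean dimensions only see N tending to infinity. *)
definition bowen :: "('a \<Rightarrow> 'a) \<Rightarrow> ('a \<Rightarrow> 'a \<Rightarrow> real) \<Rightarrow> nat \<Rightarrow> 'a \<Rightarrow> 'a \<Rightarrow> real" where
  "bowen T d N x y = Max ((\<lambda>n. d ((T ^^ n) x) ((T ^^ n) y)) ` {..<N})"

(* The limit in N exists for every compact system, by subadditivity of N |-> ln #(X, d_N, \<epsilon>). *)
definition entropy_ratio :: "'a set \<Rightarrow> ('a \<Rightarrow> 'a) \<Rightarrow> ('a \<Rightarrow> 'a \<Rightarrow> real) \<Rightarrow> real \<Rightarrow> ereal" where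
  "entropy_ratio X T d \<epsilon> =
     lim (\<lambda>N. ereal (ln (real (cover_num X (bowen T d N) \<epsilon>)) / (real N * ln (1 / \<epsilon>))))"

definition upper_mdim_M :: "'a set \<Rightarrow> ('a \<Rightarrow> 'a) \<Rightarrow> ('a \<Rightarrow> 'a \<Rightarrow> real) \<Rightarrow> ereal" where
  "upper_mdim_M X T d = Limsup (at_right 0) (entropy_ratio X T d)"

definition lower_mdim_M :: "'a set \<Rightarrow> ('a \<Rightarrow> 'a) \<Rightarrow> ('a \<Rightarrow> 'a \<Rightarrow> real) \<Rightarrow> ereal" where
  "lower_mdim_M X T d = Liminf (at_right 0) (entropy_ratio X T d)"

(* The limits in \<epsilon> exist since dim_H increases as \<epsilon> decreases. *)
definition upper_mdim_H :: "'a set \<Rightarrow> ('a \<Rightarrow> 'a) \<Rightarrow> ('a \<Rightarrow> 'a \<Rightarrow> real) \<Rightarrow> ereal" where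
  "upper_mdim_H X T d =
     Lim (at_right 0) (\<lambda>\<epsilon>. limsup (\<lambda>N. dim_H X (bowen T d N) \<epsilon> / ereal (real N)))"

definition lower_mdim_H :: "'a set \<Rightarrow> ('a \<Rightarrow> 'a) \<Rightarrow> ('a \<Rightarrow> 'a \<Rightarrow> real) \<Rightarrow> ereal" where
  "lower_mdim_H X T d =
     Lim (at_right 0) (\<lambda>\<epsilon>. liminf (\<lambda>N. dim_H X (bowen T d N) \<epsilon> / ereal (real N)))"


section \<open>Subshifts and their projections\<close>

text \<open>
  A tuple indexed by \<open>l = 1, \<dots>, i\<close> is a function that is \<open>undefined\<close> outside \<open>{1..i}\<close>.
  Sequences are indexed from 0 instead of 1, so that the term of index \<open>n\<close> below is the
  \<open>(n+1)\<close>-st term. A point of the symbolic space is a sequence of tuples, \<open>x n l\<close> being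
  the \<open>l\<close>-th component of its term of index \<open>n\<close>.
\<close>

definition alphabet :: "(nat \<Rightarrow> nat) \<Rightarrow> nat \<Rightarrow> (nat \<Rightarrow> nat) set" where
  "alphabet m i = (\<Pi>\<^sub>E l\<in>{1..i}. {..<m l})"

definition seq_shift :: "(nat \<Rightarrow> 'a) \<Rightarrow> nat \<Rightarrow> 'a" where
  "seq_shift x = (\<lambda>n. x (Suc n))"

definition subshift :: "'a set \<Rightarrow> (nat \<Rightarrow> 'a) set \<Rightarrow> bool" where
  "subshift A \<Omega> \<longleftrightarrow>
     closedin (product_topology (\<lambda>_. discrete_topology A) UNIV) \<Omega> \<and> seq_shift ` \<Omega> \<subseteq> \<Omega>"

definition proj :: "nat \<Rightarrow> (nat \<Rightarrow> nat \<Rightarrow> nat) \<Rightarrow> nat \<Rightarrow> nat \<Rightarrow> nat" where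
  "proj i x = (\<lambda>n. restrict (x n) {1..i})"

definition proj_words :: "nat \<Rightarrow> (nat \<Rightarrow> nat \<Rightarrow> nat) set \<Rightarrow> nat \<Rightarrow> (nat \<Rightarrow> nat \<Rightarrow> nat) set" where
  "proj_words i \<Omega> N = (\<lambda>x. restrict x {..<N}) ` (proj i ` \<Omega>)"

definition tau_word :: "nat \<Rightarrow> nat \<Rightarrow> nat \<Rightarrow> (nat \<Rightarrow> nat \<Rightarrow> nat) \<Rightarrow> nat \<Rightarrow> nat \<Rightarrow> nat" where
  "tau_word r i N u = (\<lambda>n\<in>{..<N}. restrict (u n) {1..r - i})"

definition tau_fiber ::
    "nat \<Rightarrow> (nat \<Rightarrow> nat \<Rightarrow> nat) set \<Rightarrow> nat \<Rightarrow> nat \<Rightarrow> (nat \<Rightarrow> nat \<Rightarrow> nat) \<Rightarrow> (nat \<Rightarrow> nat \<Rightarrow> nat) set" where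
  "tau_fiber r \<Omega> i N v = {u \<in> proj_words (r - i + 1) \<Omega> N. tau_word r i N u = v}"

lemma subshift_subset: "subshift A \<Omega> \<Longrightarrow> x \<in> \<Omega> \<Longrightarrow> x n \<in> A"
  by (auto simp: subshift_def dest!: closedin_subset)
     (metis PiE_mem UNIV_I subsetD)

lemma proj_id: "subshift (alphabet m r) \<Omega> \<Longrightarrow> x \<in> \<Omega> \<Longrightarrow> proj r x = x"
  using subshift_subset[of "alphabet m r" \<Omega> x]
  by (auto simp: proj_def alphabet_def PiE_iff extensional_restrict)

lemma tau_word_range:
  assumes "1 \<le> i" "i < r" "u \<in> proj_words (r - i + 1) \<Omega> N"
  shows "tau_word r i N u \<in> proj_words (r - i) \<Omega> N"
proof -
  obtain x where x: "x \<in> \<Omega>" "u = restrict (proj (r - i + 1) x) {..<N}"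
    using assms(3) by (auto simp: proj_words_def)
  have "tau_word r i N u = restrict (proj (r - i) x) {..<N}"
    unfolding x(2) tau_word_def proj_def by (auto simp: fun_eq_iff restrict_def)
  then show ?thesis using x(1) by (auto simp: proj_words_def)
qed


section \<open>Sponge systems\<close>

text \<open>
  A point of \<open>([0,1]\<^sup>\<nat>)\<^sup>r\<close> is an \<open>r\<close>-tuple of sequences, \<open>x l k\<close> being the term of index \<open>k\<close>
  of its \<open>l\<close>-th component.
\<close>

definition cube_space :: "nat \<Rightarrow> (nat \<Rightarrow> nat \<Rightarrow> real) set" where
  "cube_space r = (\<Pi>\<^sub>E l\<in>{1..r}. UNIV \<rightarrow> {0..1})"

(* infsum is 0 (suminf is unspecified) when the series diverges, so that the function is
   nonnegative on the whole type, as the locale Metric_space requires. *)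
definition sponge_dist :: "nat \<Rightarrow> (nat \<Rightarrow> nat \<Rightarrow> real) \<Rightarrow> (nat \<Rightarrow> nat \<Rightarrow> real) \<Rightarrow> real" where
  "sponge_dist r x y = (\<Sum>\<^sub>\<infinity>k. (1/2) ^ Suc k * Max ((\<lambda>l. \<bar>x l k - y l k\<bar>) ` {1..r}))"

definition sponge_shift :: "nat \<Rightarrow> (nat \<Rightarrow> nat \<Rightarrow> real) \<Rightarrow> nat \<Rightarrow> nat \<Rightarrow> real" where
  "sponge_shift r x = (\<lambda>l\<in>{1..r}. seq_shift (x l))"

(* As nat is discrete, bounded continuous functions on nat are the elements of l^infinity,
   with the supremum norm. In sponge, \<omega> k is the k-th point (x_{k,1}, ..., x_{k,r}) of \<Omega>. *)
definition linfty :: "(nat \<Rightarrow> nat) \<Rightarrow> nat \<Rightarrow>\<^sub>C real" where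
  "linfty u = Bcontfun (\<lambda>n. real (u n))"

definition sponge :: "nat \<Rightarrow> (nat \<Rightarrow> nat) \<Rightarrow> (nat \<Rightarrow> nat \<Rightarrow> nat) set \<Rightarrow> (nat \<Rightarrow> nat \<Rightarrow> real) set" where
  "sponge r m \<Omega> =
     {\<lambda>l\<in>{1..r}. apply_bcontfun (\<Sum>k. (1 / real (m l) ^ Suc k) *\<^sub>R linfty (\<lambda>n. \<omega> k n l))
      | \<omega>. \<forall>k. \<omega> k \<in> \<Omega>}"

lemma apply_linfty:
  assumes "\<And>n. u n < b"
  shows "apply_bcontfun (linfty u) = (\<lambda>n. real (u n))"
proof -
  have "(\<lambda>n. real (u n)) \<in> bcontfun"
    by (rule bcontfun_normI[where b = "real b"]) (use assms less_imp_le in \<open>auto\<close>)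
  then show ?thesis by (simp add: linfty_def Bcontfun_inverse)
qed

lemma sponge_series:
  assumes "2 \<le> b" and u: "\<And>k n. u k n < b"
  shows "summable (\<lambda>k. (1 / real b ^ Suc k) *\<^sub>R linfty (u k))"
    and "(\<lambda>k. real (u k n) / real b ^ Suc k) sums
           apply_bcontfun (\<Sum>k. (1 / real b ^ Suc k) *\<^sub>R linfty (u k)) n"
proof -
  let ?F = "\<lambda>k. (1 / real b ^ Suc k) *\<^sub>R linfty (u k)"
  have bl: "bounded_linear (\<lambda>f :: nat \<Rightarrow>\<^sub>C real. apply_bcontfun f n)" for n
    by (rule bounded_linear_intro[where K = 1]) (use norm_bounded[where 'b = real] in \<open>auto simp del: real_norm_def\<close>)
  have le: "norm (?F k n) \<le> (1 / real b) ^ k" for k n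
  proof -
    have "real (u k n) \<le> real b" using u[of k n] by simp
    then show ?thesis using \<open>2 \<le> b\<close> by (simp add: apply_linfty[OF u] field_simps power_divide)
  qed
  have "summable (\<lambda>k. (1 / real b) ^ k)"
    using \<open>2 \<le> b\<close> by (intro summable_geometric) auto
  then have "uniform_limit UNIV (\<lambda>K n. \<Sum>k<K. ?F k n) (\<lambda>n. \<Sum>k. ?F k n) sequentially"
    by (intro Weierstrass_m_test[where M = "\<lambda>k. (1 / real b) ^ k"] le)
  moreover have "apply_bcontfun (\<Sum>k<K. ?F k) = (\<lambda>n. \<Sum>k<K. ?F k n)" for K
    by (rule ext) (rule linear_sum[OF bounded_linear.linear[OF bl]])
  ultimately have "uniform_limit UNIV (\<lambda>K. apply_bcontfun (\<Sum>k<K. ?F k)) (\<lambda>n. \<Sum>k. ?F k n) sequentially"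
    by (simp only:)
  from uniform_limit_bcontfunE[OF this sequentially_bot]
  obtain L where "(\<lambda>K. \<Sum>k<K. ?F k) \<longlonglongrightarrow> L" by blast
  then show s: "summable ?F"
    by (auto simp: summable_def sums_def)
  from bounded_linear.sums[OF bl summable_sums[OF s]]
  show "(\<lambda>k. real (u k n) / real b ^ Suc k) sums
           apply_bcontfun (\<Sum>k. (1 / real b ^ Suc k) *\<^sub>R linfty (u k)) n"
    by (simp add: apply_linfty[OF u])
qed

lemma sponge_subset_cube:
  assumes m: "\<forall>l\<in>{1..r}. 2 \<le> m l" and "subshift (alphabet m r) \<Omega>"
  shows "sponge r m \<Omega> \<subseteq> cube_space r"
proof -
  have "apply_bcontfun (\<Sum>k. (1 / real (m l) ^ Suc k) *\<^sub>R linfty (\<lambda>n. \<omega> k n l)) n \<in> {0..1}"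
    if \<omega>: "\<forall>k. \<omega> k \<in> \<Omega>" and l: "l \<in> {1..r}" for \<omega> l n
  proof -
    define b where "b = m l"
    have b: "2 \<le> b" using m l by (auto simp: b_def)
    have u: "\<omega> k n l < b" for k n
      using subshift_subset[OF assms(2), of "\<omega> k" n] \<omega> l
      by (auto simp: alphabet_def b_def PiE_iff)
    have "(\<lambda>k. (1 / real b) ^ k) sums (1 / (1 - 1 / real b))"
      using b by (intro geometric_sums) auto
    then have "(\<lambda>k. (real b - 1) / real b * (1 / real b) ^ k)
                 sums ((real b - 1) / real b * (1 / (1 - 1 / real b)))"
      by (rule sums_mult)
    then have g: "(\<lambda>k. (real b - 1) / real b * (1 / real b) ^ k) sums 1"
      using b by (simp add: field_simps)
    note s = sponge_series(2)[of b "\<lambda>k n. \<omega> k n l" n, OF b u]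
    have "real (\<omega> k n l) / real b ^ Suc k \<le> (real b - 1) / real b * (1 / real b) ^ k" for k
    proof -
      have "real (\<omega> k n l) \<le> real b - 1" using u[of k n] by linarith
      then show ?thesis using b by (simp add: field_simps power_divide)
    qed
    from sums_le[OF this s g]
    have "apply_bcontfun (\<Sum>k. (1 / real b ^ Suc k) *\<^sub>R linfty (\<lambda>n. \<omega> k n l)) n \<le> 1" .
    moreover have "0 \<le> apply_bcontfun (\<Sum>k. (1 / real b ^ Suc k) *\<^sub>R linfty (\<lambda>n. \<omega> k n l)) n"
      by (rule sums_le[OF _ sums_zero s]) simp
    ultimately show ?thesis by (simp add: b_def)
  qed
  then show ?thesis unfolding sponge_def cube_space_def by fastforce
qed

lemma sponge_shift_invariant:
  assumes m: "\<forall>l\<in>{1..r}. 2 \<le> m l" and "subshift (alphabet m r) \<Omega>"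
  shows "sponge_shift r ` sponge r m \<Omega> \<subseteq> sponge r m \<Omega>"
proof
  fix y assume "y \<in> sponge_shift r ` sponge r m \<Omega>"
  then obtain \<omega> where \<omega>: "\<forall>k. \<omega> k \<in> \<Omega>"
    and y: "y = sponge_shift r (\<lambda>l\<in>{1..r}. apply_bcontfun
                  (\<Sum>k. (1 / real (m l) ^ Suc k) *\<^sub>R linfty (\<lambda>n. \<omega> k n l)))"
    by (auto simp: sponge_def)
  have \<omega>': "\<forall>k. seq_shift (\<omega> k) \<in> \<Omega>"
    using \<omega> assms(2) by (auto simp: subshift_def)
  have "seq_shift (apply_bcontfun (\<Sum>k. (1 / real (m l) ^ Suc k) *\<^sub>R linfty (\<lambda>n. \<omega> k n l)))
      = apply_bcontfun (\<Sum>k. (1 / real (m l) ^ Suc k) *\<^sub>R linfty (\<lambda>n. seq_shift (\<omega> k) n l))"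
    if l: "l \<in> {1..r}" for l
  proof
    fix n
    have u: "\<omega> k n l < m l" for k n
      using subshift_subset[OF assms(2), of "\<omega> k" n] \<omega> l by (auto simp: alphabet_def PiE_iff)
    show "seq_shift (apply_bcontfun (\<Sum>k. (1 / real (m l) ^ Suc k) *\<^sub>R linfty (\<lambda>n. \<omega> k n l))) n
        = apply_bcontfun (\<Sum>k. (1 / real (m l) ^ Suc k) *\<^sub>R linfty (\<lambda>n. seq_shift (\<omega> k) n l)) n"
      using sums_unique2[OF sponge_series(2)[of "m l" "\<lambda>k n. \<omega> k n l" "Suc n"]
              sponge_series(2)[of "m l" "\<lambda>k n. seq_shift (\<omega> k) n l" n, unfolded seq_shift_def]]
        m l u by (simp add: seq_shift_def)
  qed
  then have "y = (\<lambda>l\<in>{1..r}. apply_bcontfun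
                  (\<Sum>k. (1 / real (m l) ^ Suc k) *\<^sub>R linfty (\<lambda>n. seq_shift (\<omega> k) n l)))"
    unfolding y sponge_shift_def by (auto simp: restrict_def)
  then show "y \<in> sponge r m \<Omega>"
    using \<omega>' unfolding sponge_def by (intro CollectI exI[of _ "\<lambda>k. seq_shift (\<omega> k)"]) auto
qed

lemma sponge_dist_sums:
  assumes "1 \<le> r" "x \<in> cube_space r" "y \<in> cube_space r"
  shows "(\<lambda>k. (1/2) ^ Suc k * Max ((\<lambda>l. \<bar>x l k - y l k\<bar>) ` {1..r})) sums sponge_dist r x y"
proof -
  let ?M = "\<lambda>k. Max ((\<lambda>l. \<bar>x l k - y l k\<bar>) ` {1..r})"
  have le: "\<bar>x l k - y l k\<bar> \<le> 1" if "l \<in> {1..r}" for l k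
  proof -
    have "x l k \<in> {0..1}" "y l k \<in> {0..1}"
      using assms(2,3) that unfolding cube_space_def by (blast dest: PiE_mem PiE_mem funcset_mem)+
    then show ?thesis by auto
  qed
  have M1: "?M k \<le> 1" for k using le \<open>1 \<le> r\<close> by (subst Max_le_iff) auto
  have "\<bar>x 1 k - y 1 k\<bar> \<le> ?M k" for k using \<open>1 \<le> r\<close> by (intro Max_ge) auto
  then have M0: "0 \<le> ?M k" for k using order_trans[OF abs_ge_zero] by blast
  have "summable (\<lambda>k. (1/2 :: real) ^ k)" by (rule summable_geometric) simp
  moreover have "norm ((1/2) ^ Suc k * ?M k) \<le> (1/2) ^ k" for k
  proof -
    have "(1/2) ^ Suc k * ?M k \<le> (1/2) ^ k * 1"
      using M1[of k] M0[of k] by (intro mult_mono) auto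
    then show ?thesis using M0[of k] by (simp add: abs_mult)
  qed
  ultimately have s: "summable (\<lambda>k. norm ((1/2) ^ Suc k * ?M k))"
    by (intro summable_comparison_test'[where N = 0 and f = "\<lambda>k. norm ((1/2) ^ Suc k * ?M k)"
          and g = "\<lambda>k. (1/2 :: real) ^ k"]) auto
  have "(\<lambda>k. (1/2) ^ Suc k * ?M k) summable_on UNIV"
    by (rule norm_summable_imp_summable_on[OF s])
  from has_sum_imp_sums[OF has_sum_infsum[OF this]] show ?thesis by (simp add: sponge_dist_def)
qed

lemma Metric_space_cube:
  assumes "1 \<le> r"
  shows "Metric_space (cube_space r) (sponge_dist r)"
proof
  let ?M = "\<lambda>x y k. Max ((\<lambda>l. \<bar>x l k - y l k\<bar>) ` {1..r}) :: real"
  have ge: "\<bar>x l k - y l k\<bar> \<le> ?M x y k" if "l \<in> {1..r}" for l and x :: "nat \<Rightarrow> nat \<Rightarrow> real" and k y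
    using that by (intro Max_ge) auto
  have M0: "0 \<le> ?M x y k" for x :: "nat \<Rightarrow> nat \<Rightarrow> real" and k y
    by (rule order_trans[OF abs_ge_zero ge[of 1]]) (use assms in \<open>simp\<close>)
  show "0 \<le> sponge_dist r x y" for x y
    unfolding sponge_dist_def using M0 by (intro infsum_nonneg mult_nonneg_nonneg) auto
  show "sponge_dist r x y = sponge_dist r y x" for x y
    by (simp add: sponge_dist_def abs_minus_commute)
  show "sponge_dist r x y = 0 \<longleftrightarrow> x = y" if x: "x \<in> cube_space r" and y: "y \<in> cube_space r" for x y
  proof
    assume d0: "sponge_dist r x y = 0"
    have z: "(\<lambda>k. (1/2) ^ Suc k * ?M x y k) sums 0"
      using sponge_dist_sums[OF assms x y] unfolding d0 .
    have nn: "0 \<le> (1/2) ^ Suc k * ?M x y k" for k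
      by (rule mult_nonneg_nonneg[OF _ M0]) simp
    have "?M x y k = 0" for k
      using suminf_eq_zero_iff[OF sums_summable[OF z] nn] sums_unique[OF z, symmetric] by (simp only: mult_eq_0_iff) simp
    then have "x l k = y l k" if "l \<in> {1..r}" for l k
      using ge[OF that, of x k y] by simp
    then have "x l = y l" for l
      using x y by (cases "l \<in> {1..r}") (auto simp: cube_space_def PiE_iff extensional_def)
    then show "x = y" ..
  next
    have "(\<lambda>l. 0 :: real) ` {1..r} = {0}" using assms by auto
    then show "sponge_dist r x y = 0" if "x = y" using that by (simp add: sponge_dist_def)
  qed
  show "sponge_dist r x z \<le> sponge_dist r x y + sponge_dist r y z"
    if x: "x \<in> cube_space r" and y: "y \<in> cube_space r" and z: "z \<in> cube_space r" for x y z
  proof (rule sums_le[OF _ sponge_dist_sums[OF assms x z]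
        sums_add[OF sponge_dist_sums[OF assms x y] sponge_dist_sums[OF assms y z]]])
    fix k
    have "\<bar>x l k - z l k\<bar> \<le> ?M x y k + ?M y z k" if "l \<in> {1..r}" for l
      using ge[OF that, of x k y]
        ge[OF that, of y k z] by linarith
    then have "?M x z k \<le> ?M x y k + ?M y z k"
      using assms by (subst Max_le_iff) auto
    then show "(1/2) ^ Suc k * ?M x z k \<le> (1/2) ^ Suc k * ?M x y k + (1/2) ^ Suc k * ?M y z k"
      by (simp add: distrib_left[symmetric])
  qed
qed

end

theory Submission
  imports Defs "HOL-Probability.Infinite_Product_Measure"
begin

text \<open>
  Write \<open>C i N\<close> for the number of words of length \<open>N\<close> of the projection of \<open>\<Omega>\<close> to the first \<open>i\<close>
  coordinates and \<open>h i\<close> for its entropy, the limit of \<open>ln (C i N) / N\<close>, so that \<open>h 0 = 0\<close>. All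
  four mean dimensions are equal to \<open>D = (\<Sum>l=1..r. (h l - h (l - 1)) / ln (m l))\<close>.

  The upper bounds come from counting approximate squares. Fix a scale \<open>exp (-\<tau>)\<close>. Knowing
  coordinate \<open>l\<close> up to that scale means knowing about \<open>\<tau> / ln (m l)\<close> digits in base \<open>m l\<close>, and this
  number decreases in \<open>l\<close>. So at the \<open>k\<close>-th digit only an initial segment of the coordinates is
  visible, and a sequence \<open>\<omega>\<close> in \<open>\<Omega>\<close> contributes only its projected words of length \<open>N\<close>. The
  logarithm of the number of possibilities is a sum over \<open>k\<close> of terms \<open>ln (C i N)\<close>, and summation by
  parts turns it into \<open>\<tau> * N * D\<close> up to a lower order error (\<open>ln_card_squares_depth\<close>). Since the
  mean Hausdorff dimension never exceeds the metric mean dimension (\<open>dim_H_le_cover_num\<close>), this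
  settles the upper bound for both.

  The lower bounds come from a probability measure on the sponge: draw the words of length \<open>N\<close> of
  the digit sequences \<open>\<omega> 0, \<omega> 1, \<dots>\<close> independently and uniformly among the words of \<open>\<Omega>\<close>. The
  hypothesis on the fibers says that, up to a factor subexponential in \<open>N\<close>, all fibers of one
  projection have the same size. Hence each projection of the uniform measure on words is again
  almost uniform (\<open>eventually_card_words_over\<close>), and every approximate square has almost the same
  mass. A set of small diameter meets only \<open>exp (O(N))\<close> approximate squares, a number that does not
  depend on the scale, so the mass of a set of diameter below \<open>\<rho>\<close> is at most
  \<open>exp (O(N)) * \<rho> powr (N * (D - \<delta>))\<close> (\<open>frostman_words\<close>). By the mass distribution principle this
  bounds from below both the covering numbers and the Hausdorff sums; the factor \<open>exp (O(N))\<close>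
  disappears as the scale tends to 0.

  The passage from these two estimates to the four mean dimensions is not specific to sponges
  (\<open>mean_dimensions_eq\<close>).
\<close>

section \<open>Subadditive sequences\<close>

text \<open>
  Writing \<open>n = q * k + s\<close> with a bounded remainder \<open>s\<close> gives \<open>a n \<le> q * a k + O(1)\<close>, so that
  \<open>a n / n\<close> is eventually below any value strictly above \<open>a k / k\<close>; the limit is the infimum.
  It is used for covering numbers and for numbers of words.
\<close>

lemma fekete:
  fixes a :: "nat \<Rightarrow> real"
  assumes sub: "\<And>i j. 1 \<le> i \<Longrightarrow> 1 \<le> j \<Longrightarrow> a (i + j) \<le> a i + a j"
    and nonneg: "\<And>i. 0 \<le> a i"
  shows "\<exists>l. (\<lambda>n. a n / real n) \<longlonglongrightarrow> l"
proof -
  define l where "l = (INF n\<in>{1::nat..}. a n / real n)"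
  have bdd: "bdd_below ((\<lambda>n. a n / real n) ` {1::nat..})"
    by (rule bdd_belowI[where m = 0]) (use nonneg in auto)
  have lower: "l \<le> a n / real n" if "1 \<le> n" for n
    unfolding l_def using that by (intro cINF_lower[OF bdd]) auto
  have step: "a (q * k + s) \<le> real q * a k + a s" if "1 \<le> k" "1 \<le> s" for q k s
  proof (induction q)
    case (Suc q)
    have "a (Suc q * k + s) = a (k + (q * k + s))" by (simp add: algebra_simps)
    also have "\<dots> \<le> a k + a (q * k + s)" using that by (intro sub) auto
    also have "\<dots> \<le> a k + (real q * a k + a s)" using Suc by simp
    finally show ?case by (simp add: algebra_simps)
  qed simp
  have "(\<lambda>n. a n / real n) \<longlonglongrightarrow> l"
  proof (rule LIMSEQ_I)
    fix e :: real assume e: "0 < e"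
    have "\<exists>k\<in>{1::nat..}. a k / real k < l + e / 2"
      using cINF_less_iff[OF _ bdd, of "l + e / 2"] e unfolding l_def by auto
    then obtain k where k: "1 \<le> k" "a k / real k < l + e / 2" by auto
    define B where "B = (\<Sum>s\<in>{1..k}. a s)"
    have B: "a s \<le> B" if "1 \<le> s" "s \<le> k" for s
      unfolding B_def by (rule member_le_sum) (use that nonneg in auto)
    have "0 \<le> B" unfolding B_def by (intro sum_nonneg nonneg)
    obtain n0 :: nat where n0: "2 * B / e < real n0" using reals_Archimedean2 by blast
    show "\<exists>no. \<forall>n\<ge>no. norm (a n / real n - l) < e"
    proof (intro exI[of _ "Suc n0"] allI impI)
      fix n assume n: "Suc n0 \<le> n"
      then have n1: "1 \<le> n" by simp
      \<comment> \<open>The remainder is taken in \<open>{1..k}\<close>, as subadditivity says nothing about index 0.\<close>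
      define q where "q = (n - 1) div k"
      define s where "s = (n - 1) mod k + 1"
      have "q * k + (n - 1) mod k = n - 1" by (simp add: q_def)
      then have nq: "n = q * k + s" using n1 unfolding s_def by linarith
      have s: "1 \<le> s" "s \<le> k" using k(1) by (auto simp: s_def Suc_le_eq)
      have "a n \<le> real q * a k + B"
        using step[OF k(1) s(1), of q] B[OF s] unfolding nq by linarith
      moreover have "real q * a k \<le> real n * (a k / real k)"
      proof -
        have "real q * real k \<le> real n" unfolding nq by simp
        then have "real q * real k * (a k / real k) \<le> real n * (a k / real k)"
          using nonneg by (intro mult_right_mono) auto
        then show ?thesis using k(1) by simp
      qed
      ultimately have "a n / real n \<le> a k / real k + B / real n"
        using n1 by (simp add: field_simps)
      moreover have "B / real n < e / 2"
      proof -
        have "2 * B / e < real n" using n0 n by linarith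
        then show ?thesis using e n1 by (simp add: field_simps)
      qed
      ultimately show "norm (a n / real n - l) < e"
        using k(2) lower[OF n1] unfolding real_norm_def abs_less_iff by linarith
    qed
  qed
  then show ?thesis by blast
qed

section \<open>Covering numbers and Hausdorff sums of a bounded metric space\<close>

text \<open>The predicate that \<open>cover_num\<close> minimises over \<open>n\<close>.\<close>
definition finite_open_cover :: "'a set \<Rightarrow> ('a \<Rightarrow> 'a \<Rightarrow> real) \<Rightarrow> real \<Rightarrow> nat \<Rightarrow> bool" where
  "finite_open_cover X d \<epsilon> n \<longleftrightarrow> 1 \<le> n \<and> (\<exists>U :: nat \<Rightarrow> 'a set.
     (\<forall>i<n. openin (Metric_space.mtopology X d) (U i) \<and> diam_on d (U i) < \<epsilon>) \<and> X = (\<Union>i<n. U i))"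

lemma finite_open_cover_cover_num:
  "finite_open_cover X d \<epsilon> n \<Longrightarrow> finite_open_cover X d \<epsilon> (cover_num X d \<epsilon>)"
  unfolding cover_num_def finite_open_cover_def by (rule LeastI)

lemma cover_num_le: "finite_open_cover X d \<epsilon> n \<Longrightarrow> cover_num X d \<epsilon> \<le> n"
  unfolding cover_num_def finite_open_cover_def by (rule Least_le)

text \<open>
  The diameter is a supremum of reals, hence only meaningful for bounded sets. A diameter bound
  of 1 is what the sponge metric and all its dynamical metrics satisfy.
\<close>
locale bounded_metric = Metric_space X d for X :: "'a set" and d +
  assumes nonempty: "X \<noteq> {}"
    and le_1: "\<And>x y. x \<in> X \<Longrightarrow> y \<in> X \<Longrightarrow> d x y \<le> 1"
begin

lemma diam_on_ge:
  assumes "E \<subseteq> X" "x \<in> E" "y \<in> E"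
  shows "d x y \<le> diam_on d E"
proof -
  have "bdd_above ((\<lambda>(x, y). d x y) ` (E \<times> E))"
    by (rule bdd_aboveI[where M = 1]) (use assms le_1 in auto)
  from cSUP_upper[OF _ this, of "(x, y)"] show ?thesis using assms by (auto simp: diam_on_def)
qed

lemma diam_on_le:
  assumes "0 \<le> c" "\<And>x y. x \<in> E \<Longrightarrow> y \<in> E \<Longrightarrow> d x y \<le> c"
  shows "diam_on d E \<le> c"
  unfolding diam_on_def using assms by (auto intro!: cSUP_least)

lemma diam_on_nonneg: "E \<subseteq> X \<Longrightarrow> 0 \<le> diam_on d E"
  by (cases "E = {}") (auto simp: diam_on_def[of d "{}"] intro: order_trans[OF nonneg diam_on_ge])

text \<open>
  One representative per value of the code \<open>\<kappa>\<close> gives a \<open>\<rho>\<close>-net; the balls of radius \<open>2 * \<rho>\<close>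
  around it are open, which the code classes themselves need not be.
\<close>
lemma finite_open_cover_code:
  assumes X: "X = \<Phi> ` S" and fin: "finite (\<kappa> ` S)" and pos: "0 < \<rho>" "4 * \<rho> < \<epsilon>"
    and close: "\<And>\<omega> \<omega>'. \<omega> \<in> S \<Longrightarrow> \<omega>' \<in> S \<Longrightarrow> \<kappa> \<omega> = \<kappa> \<omega>' \<Longrightarrow> d (\<Phi> \<omega>) (\<Phi> \<omega>') \<le> \<rho>"
  shows "finite_open_cover X d \<epsilon> (card (\<kappa> ` S))"
proof -
  obtain g where g: "bij_betw g {0..<card (\<kappa> ` S)} (\<kappa> ` S)"
    using ex_bij_betw_nat_finite[OF fin] by blast
  define c where "c i = \<Phi> (inv_into S \<kappa> (g i))" for i
  have cX: "c i \<in> X" if "i < card (\<kappa> ` S)" for i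
    using bij_betwE[OF g] that unfolding c_def X by (intro imageI inv_into_into) auto
  have "diam_on d (mball (c i) (2 * \<rho>)) \<le> 4 * \<rho>" for i
  proof (rule diam_on_le)
    fix x y assume "x \<in> mball (c i) (2 * \<rho>)" "y \<in> mball (c i) (2 * \<rho>)"
    then show "d x y \<le> 4 * \<rho>" using triangle[of x "c i" y] commute[of x "c i"] by auto
  qed (use pos in simp)
  then have "diam_on d (mball (c i) (2 * \<rho>)) < \<epsilon>" for i using pos(2) le_less_trans by blast
  moreover have "X = (\<Union>i<card (\<kappa> ` S). mball (c i) (2 * \<rho>))"
  proof
    show "X \<subseteq> (\<Union>i<card (\<kappa> ` S). mball (c i) (2 * \<rho>))"
    proof
      fix x assume x: "x \<in> X"
      then obtain \<omega> where w: "\<omega> \<in> S" "x = \<Phi> \<omega>" using X by auto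
      obtain i where i: "i < card (\<kappa> ` S)" "g i = \<kappa> \<omega>"
        using bij_betw_imp_surj_on[OF g] w(1) by (metis atLeastLessThan_iff imageE image_eqI)
      have "inv_into S \<kappa> (g i) \<in> S" "\<kappa> (inv_into S \<kappa> (g i)) = \<kappa> \<omega>"
        unfolding i(2) using w(1) by (auto intro: inv_into_into f_inv_into_f)
      then have "d (c i) x \<le> \<rho>" unfolding c_def w(2) using w(1) by (intro close)
      then show "x \<in> (\<Union>i<card (\<kappa> ` S). mball (c i) (2 * \<rho>))"
        using x i cX[OF i(1)] pos(1) by (auto intro!: bexI[of _ i])
    qed
  qed auto
  moreover have "1 \<le> card (\<kappa> ` S)"
    using nonempty fin unfolding X by (auto simp: Suc_le_eq card_gt_0_iff)
  ultimately show ?thesis unfolding finite_open_cover_def by (auto intro!: exI openin_mball)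
qed

text \<open>
  An optimal open cover at the finer scale \<open>\<epsilon>'\<close> is admissible for the Hausdorff sum at scale \<open>\<epsilon>\<close>,
  and its sum is at most \<open>cover_num X d \<epsilon>' * \<epsilon>' powr s\<close>, which is below 1 once \<open>s\<close> exceeds the
  stated quotient.
\<close>
lemma dim_H_le_cover_num:
  assumes cov: "finite_open_cover X d \<epsilon>' n" and e: "0 < \<epsilon>'" "\<epsilon>' < 1" "\<epsilon>' \<le> \<epsilon>"
  shows "dim_H X d \<epsilon> \<le> ereal (ln (real (cover_num X d \<epsilon>')) / ln (1 / \<epsilon>'))"
  unfolding dim_H_def
proof (rule SUP_least)
  fix s assume "s \<in> {s. 0 \<le> s \<and> 1 \<le> hausdorff_sum s X d \<epsilon>}"
  then have s: "0 \<le> s" "1 \<le> hausdorff_sum s X d \<epsilon>" by auto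
  define k where "k = cover_num X d \<epsilon>'"
  have "finite_open_cover X d \<epsilon>' k"
    unfolding k_def by (rule finite_open_cover_cover_num[OF cov])
  then obtain U where k1: "1 \<le> k"
    and U: "\<And>i. i < k \<Longrightarrow> openin mtopology (U i)" "\<And>i. i < k \<Longrightarrow> diam_on d (U i) < \<epsilon>'"
    and XU: "X = (\<Union>i<k. U i)"
    unfolding finite_open_cover_def by blast
  have l: "0 < ln (1 / \<epsilon>')" using e by simp
  have UX: "U i \<subseteq> X" if "i < k" for i using U(1)[OF that] openin_subset by fastforce
  show "ereal s \<le> ereal (ln (real (cover_num X d \<epsilon>')) / ln (1 / \<epsilon>'))"
  proof (rule ccontr)
    assume "\<not> ?thesis"
    then have "ln (real k) / ln (1 / \<epsilon>') < s" by (simp add: k_def)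
    then have lt: "ln (real k) < s * ln (1 / \<epsilon>')" using l by (simp add: field_simps)
    have s0: "0 < s"
    proof (rule ccontr)
      assume "\<not> 0 < s"
      then have "s = 0" using s by simp
      then show False using lt k1 by simp
    qed
    define E where "E i = (if i < k then U i else {})" for i
    have "X = (\<Union>i. E i)" unfolding XU E_def by (auto split: if_splits)
    moreover have "diam_on d (E i) < \<epsilon>" for i
      using U(2)[of i] e by (auto simp: E_def diam_on_def[of d "{}"])
    ultimately have "hausdorff_sum s X d \<epsilon> \<le> (\<Sum>i. ennreal (diam_pow d s (E i)))"
      unfolding hausdorff_sum_def by (intro INF_lower) auto
    also have "\<dots> = (\<Sum>i<k. ennreal (diam_pow d s (E i)))"
      by (rule suminf_finite) (auto simp: E_def diam_pow_def)
    also have "\<dots> \<le> (\<Sum>i<k. ennreal (\<epsilon>' powr s))"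
    proof (intro sum_mono ennreal_leI)
      fix i assume "i \<in> {..<k}"
      then show "diam_pow d s (E i) \<le> \<epsilon>' powr s"
        using U(2)[of i] diam_on_nonneg[OF UX, of i] s0
        by (auto simp: diam_pow_def E_def intro!: powr_mono2)
    qed
    also have "\<dots> = ennreal (real k * \<epsilon>' powr s)"
      by (simp add: ennreal_mult'' ennreal_of_nat_eq_real_of_nat)
    also have "\<dots> < 1"
    proof -
      have "real k * \<epsilon>' powr s = exp (ln (real k) - s * ln (1 / \<epsilon>'))"
        using e k1 by (simp add: powr_def exp_add ln_div)
      also have "\<dots> < 1" using lt by simp
      finally show ?thesis by (simp add: ennreal_less_iff flip: ennreal_1)
    qed
    finally show False using s(2) by simp
  qed
qed

end

section \<open>The mass distribution principle\<close>

text \<open>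
  A Frostman condition for the image under \<open>\<Phi>\<close> of the measure \<open>M\<close>. The covers in the Hausdorff
  sums consist of arbitrary sets, so the mass of \<open>E\<close> is that of a measurable set containing the
  preimage of \<open>E\<close>.
\<close>
definition frostman :: "'a set \<Rightarrow> ('a \<Rightarrow> 'a \<Rightarrow> real) \<Rightarrow> 'b measure \<Rightarrow> ('b \<Rightarrow> 'a) \<Rightarrow> real \<Rightarrow> real \<Rightarrow> bool" where
  "frostman X d M \<Phi> c s \<longleftrightarrow> prob_space M \<and> \<Phi> ` space M \<subseteq> X \<and>
     (\<forall>\<rho> E. 0 < \<rho> \<longrightarrow> \<rho> \<le> 1 \<longrightarrow> E \<subseteq> X \<longrightarrow> diam_on d E < \<rho> \<longrightarrow>
        (\<exists>A\<in>sets M. {\<omega> \<in> space M. \<Phi> \<omega> \<in> E} \<subseteq> A \<and> measure M A \<le> c * \<rho> powr s))"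

context bounded_metric
begin

lemma cover_num_ge_frostman:
  assumes fr: "frostman X d M \<Phi> c s" and cov: "finite_open_cover X d \<rho> n"
    and r: "0 < \<rho>" "\<rho> \<le> 1"
  shows "1 \<le> real (cover_num X d \<rho>) * (c * \<rho> powr s)"
proof -
  define k where "k = cover_num X d \<rho>"
  interpret M: prob_space M using fr by (simp add: frostman_def)
  have "finite_open_cover X d \<rho> k"
    unfolding k_def by (rule finite_open_cover_cover_num[OF cov])
  then obtain U where U: "\<And>i. i < k \<Longrightarrow> openin mtopology (U i)" "\<And>i. i < k \<Longrightarrow> diam_on d (U i) < \<rho>"
    and XU: "X = (\<Union>i<k. U i)"
    unfolding finite_open_cover_def by blast
  have "\<exists>A. A \<in> sets M \<and> {\<omega> \<in> space M. \<Phi> \<omega> \<in> U i} \<subseteq> A \<and> measure M A \<le> c * \<rho> powr s" if "i < k" for i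
    using fr U(2)[OF that] r XU that unfolding frostman_def by blast
  then obtain A where A: "\<And>i. i < k \<Longrightarrow> A i \<in> sets M"
    "\<And>i. i < k \<Longrightarrow> {\<omega> \<in> space M. \<Phi> \<omega> \<in> U i} \<subseteq> A i"
    "\<And>i. i < k \<Longrightarrow> measure M (A i) \<le> c * \<rho> powr s" by metis
  have "space M \<subseteq> (\<Union>i<k. A i)"
  proof
    fix \<omega> assume w: "\<omega> \<in> space M"
    then have "\<Phi> \<omega> \<in> X" using fr by (auto simp: frostman_def)
    then obtain i where "i < k" "\<Phi> \<omega> \<in> U i" using XU by auto
    then show "\<omega> \<in> (\<Union>i<k. A i)" using A(2)[of i] w by auto
  qed
  then have "1 \<le> measure M (\<Union>i<k. A i)"
    using A(1) by (subst M.prob_space[symmetric]) (intro M.finite_measure_mono, auto)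
  also have "\<dots> \<le> (\<Sum>i<k. measure M (A i))"
    using A(1) by (intro M.finite_measure_subadditive_finite) auto
  also have "\<dots> \<le> (\<Sum>i<k. c * \<rho> powr s)" using A(3) by (intro sum_mono) auto
  finally show ?thesis by (simp add: k_def)
qed

text \<open>
  The gap between \<open>s'\<close> and \<open>s\<close> absorbs the constant \<open>c\<close> at scales below \<open>\<epsilon>\<close>. The factor 2 is there
  because the Frostman condition asks for a radius strictly above the diameter. The preimage of
  a set of diameter 0 lies in sets of arbitrarily small mass, whose intersection is a null set.
\<close>
lemma frostman_diam_pow:
  assumes fr: "frostman X d M \<Phi> c s" and s: "0 < s'" "s' < s"
    and \<epsilon>: "0 < \<epsilon>" "2 * \<epsilon> \<le> 1" "c * 2 powr s * \<epsilon> powr (s - s') \<le> 1"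
    and E: "E \<subseteq> X" "diam_on d E < \<epsilon>"
  shows "\<exists>A\<in>sets M. {\<omega> \<in> space M. \<Phi> \<omega> \<in> E} \<subseteq> A \<and> measure M A \<le> diam_pow d s' E"
proof -
  interpret M: prob_space M using fr by (simp add: frostman_def)
  have cover: "\<exists>A\<in>sets M. {\<omega> \<in> space M. \<Phi> \<omega> \<in> E} \<subseteq> A \<and> measure M A \<le> c * \<rho> powr s"
    if "0 < \<rho>" "\<rho> \<le> 1" "diam_on d E < \<rho>" for \<rho>
    using fr that E(1) unfolding frostman_def by blast
  consider "E = {}" | "E \<noteq> {}" "0 < diam_on d E" | "E \<noteq> {}" "diam_on d E = 0"
    using diam_on_nonneg[OF E(1)] by linarith
  then show ?thesis
  proof cases
    case 1
    then show ?thesis by (intro bexI[of _ "{}"]) (auto simp: diam_pow_def)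
  next
    case 2
    define D where "D = diam_on d E"
    have D: "0 < D" "D < \<epsilon>" using 2 E(2) by (auto simp: D_def)
    obtain A where A: "A \<in> sets M" "{\<omega> \<in> space M. \<Phi> \<omega> \<in> E} \<subseteq> A" "measure M A \<le> c * (2 * D) powr s"
      using cover[of "2 * D"] D \<epsilon> by (auto simp: D_def)
    have "c * (2 * D) powr s = (c * 2 powr s * D powr (s - s')) * D powr s'"
      using D by (simp add: powr_mult flip: powr_add)
    also have "\<dots> \<le> 1 * D powr s'"
    proof (rule mult_right_mono)
      have "c * 2 powr s * D powr (s - s') \<le> max 0 (c * 2 powr s) * D powr (s - s')"
        by (intro mult_right_mono) auto
      also have "\<dots> \<le> max 0 (c * 2 powr s) * \<epsilon> powr (s - s')"
        using D s by (intro mult_left_mono powr_mono2) auto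
      also have "\<dots> \<le> 1" using \<epsilon>(3) by (auto simp: max_def)
      finally show "c * 2 powr s * D powr (s - s') \<le> 1" .
    qed simp
    finally show ?thesis using A 2 s by (intro bexI[of _ A]) (auto simp: diam_pow_def D_def)
  next
    case 3
    have "\<exists>A. A \<in> sets M \<and> {\<omega> \<in> space M. \<Phi> \<omega> \<in> E} \<subseteq> A \<and> measure M A \<le> c * (1 / real (Suc n)) powr s" for n
      using cover[of "1 / real (Suc n)"] 3 by auto
    then obtain A where A: "\<And>n. A n \<in> sets M" "\<And>n. {\<omega> \<in> space M. \<Phi> \<omega> \<in> E} \<subseteq> A n"
      "\<And>n. measure M (A n) \<le> c * (1 / real (Suc n)) powr s" by metis
    define B where "B = (\<Inter>n. A n)"
    have B: "B \<in> sets M" unfolding B_def using A(1) by auto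
    have "(\<lambda>n. 1 / real (Suc n)) \<longlonglongrightarrow> 0" by (rule LIMSEQ_Suc[OF lim_1_over_n])
    then have "(\<lambda>n. (1 / real (Suc n)) powr s) \<longlonglongrightarrow> 0 powr s"
      using s by (intro tendsto_powr') (auto intro!: always_eventually)
    then have "(\<lambda>n. c * (1 / real (Suc n)) powr s) \<longlonglongrightarrow> c * 0 powr s" by (rule tendsto_mult_left)
    moreover have "measure M B \<le> c * (1 / real (Suc n)) powr s" for n
      using A(3)[of n] M.finite_measure_mono[of B "A n"] A(1) by (auto simp: B_def intro: order_trans)
    ultimately have "measure M B \<le> c * 0 powr s" by (intro LIMSEQ_le_const) auto
    then show ?thesis using B A(2) s 3
      by (intro bexI[of _ B]) (auto simp: B_def diam_pow_def)
  qed
qed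

lemma dim_H_ge_frostman:
  assumes fr: "frostman X d M \<Phi> c s" and s: "0 < s'" "s' < s"
    and \<epsilon>: "0 < \<epsilon>" "2 * \<epsilon> \<le> 1" "c * 2 powr s * \<epsilon> powr (s - s') \<le> 1"
  shows "ereal s' \<le> dim_H X d \<epsilon>"
proof -
  interpret M: prob_space M using fr by (simp add: frostman_def)
  have "1 \<le> (\<Sum>i. ennreal (diam_pow d s' (E i)))"
    if E: "X = (\<Union>i. E i)" "\<forall>i. diam_on d (E i) < \<epsilon>" for E :: "nat \<Rightarrow> 'a set"
  proof -
    have "\<exists>A. A \<in> sets M \<and> {\<omega> \<in> space M. \<Phi> \<omega> \<in> E i} \<subseteq> A \<and> measure M A \<le> diam_pow d s' (E i)" for i
      using frostman_diam_pow[OF fr s \<epsilon>, of "E i"] E by blast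
    then obtain A where A: "\<And>i. A i \<in> sets M" "\<And>i. {\<omega> \<in> space M. \<Phi> \<omega> \<in> E i} \<subseteq> A i"
      "\<And>i. measure M (A i) \<le> diam_pow d s' (E i)" by metis
    have "space M \<subseteq> (\<Union>i. A i)"
    proof
      fix \<omega> assume w: "\<omega> \<in> space M"
      then have "\<Phi> \<omega> \<in> X" using fr by (auto simp: frostman_def)
      then obtain i where "\<Phi> \<omega> \<in> E i" using E(1) by auto
      then show "\<omega> \<in> (\<Union>i. A i)" using A(2)[of i] w by auto
    qed
    then have "1 \<le> emeasure M (\<Union>i. A i)"
      using A(1) by (subst M.emeasure_space_1[symmetric]) (intro emeasure_mono, auto)
    also have "\<dots> \<le> (\<Sum>i. emeasure M (A i))"
      using A(1) by (intro emeasure_subadditive_countably) auto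
    also have "\<dots> \<le> (\<Sum>i. ennreal (diam_pow d s' (E i)))"
      using A(3) by (intro suminf_le) (auto simp: M.emeasure_eq_measure intro!: ennreal_leI)
    finally show ?thesis .
  qed
  then have "1 \<le> hausdorff_sum s' X d \<epsilon>"
    unfolding hausdorff_sum_def by (intro INF_greatest) auto
  then show ?thesis unfolding dim_H_def using s by (intro SUP_upper) auto
qed

lemma dim_H_nonneg: "0 \<le> dim_H X d \<epsilon>"
proof -
  have "1 \<le> (\<Sum>i. ennreal (diam_pow d 0 (E i)))"
    if "X = (\<Union>i. E i)" for E :: "nat \<Rightarrow> 'a set"
  proof -
    have "\<exists>i. E i \<noteq> {}"
    proof (rule ccontr)
      assume "\<not> ?thesis"
      then have "X = {}" using that by simp
      then show False using nonempty by simp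
    qed
    then obtain i where "E i \<noteq> {}" ..
    then have "1 = (\<Sum>j\<in>{i}. ennreal (diam_pow d 0 (E j)))" by (simp add: diam_pow_def)
    also have "\<dots> \<le> (\<Sum>i. ennreal (diam_pow d 0 (E i)))" by (intro sum_le_suminf) auto
    finally show ?thesis .
  qed
  then have "1 \<le> hausdorff_sum 0 X d \<epsilon>"
    unfolding hausdorff_sum_def by (intro INF_greatest) auto
  then have "ereal 0 \<le> dim_H X d \<epsilon>" unfolding dim_H_def by (intro SUP_upper) auto
  then show ?thesis by (simp add: zero_ereal_def)
qed

end

section \<open>Mean dimensions of a bounded system\<close>
locale bounded_system = bounded_metric X d for X :: "'a set" and d +
  fixes T :: "'a \<Rightarrow> 'a"
  assumes invariant: "x \<in> X \<Longrightarrow> T x \<in> X"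
begin

abbreviation dN :: "nat \<Rightarrow> 'a \<Rightarrow> 'a \<Rightarrow> real" where "dN \<equiv> bowen T d"

lemma funpow_invariant: "x \<in> X \<Longrightarrow> (T ^^ n) x \<in> X"
  by (induction n) (auto intro: invariant)

lemma bowen_le_iff: "1 \<le> N \<Longrightarrow> dN N x y \<le> c \<longleftrightarrow> (\<forall>n<N. d ((T ^^ n) x) ((T ^^ n) y) \<le> c)"
  unfolding bowen_def by (subst Max_le_iff) (auto simp: lessThan_empty_iff)

lemma bowen_ge: "n < N \<Longrightarrow> d ((T ^^ n) x) ((T ^^ n) y) \<le> dN N x y"
  unfolding bowen_def by (intro Max_ge) auto

lemma bounded_metric_bowen:
  assumes "1 \<le> N"
  shows "bounded_metric X (dN N)"
proof
  show nn: "0 \<le> dN N x y" for x y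
    using order_trans[OF nonneg bowen_ge[of 0 N x y]] assms by simp
  show "dN N x y = dN N y x" for x y unfolding bowen_def by (simp add: commute)
  show "dN N x y = 0 \<longleftrightarrow> x = y" if "x \<in> X" "y \<in> X" for x y
  proof
    assume "dN N x y = 0"
    then have "d x y \<le> 0" using bowen_ge[of 0 N x y] assms by simp
    then show "x = y" using zero[OF that] nonneg[of x y] order.antisym by blast
  next
    assume "x = y"
    then have "dN N x y \<le> 0" using assms funpow_invariant[OF that(1)] by (simp add: bowen_le_iff)
    then show "dN N x y = 0" using nn[of x y] by simp
  qed
  show "dN N x z \<le> dN N x y + dN N y z" if "x \<in> X" "y \<in> X" "z \<in> X" for x y z
    unfolding bowen_le_iff[OF assms]
  proof (intro allI impI)
    fix n assume "n < N"
    then show "d ((T ^^ n) x) ((T ^^ n) z) \<le> dN N x y + dN N y z"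
      using triangle[of "(T ^^ n) x" "(T ^^ n) y" "(T ^^ n) z"] funpow_invariant that
        bowen_ge[of n N x y] bowen_ge[of n N y z] by fastforce
  qed
  show "dN N x y \<le> 1" if "x \<in> X" "y \<in> X" for x y
    unfolding bowen_le_iff[OF assms] using that funpow_invariant le_1 by auto
qed (rule nonempty)

lemma bowen_add_le_iff:
  assumes "1 \<le> N" "1 \<le> M"
  shows "dN (N + M) x y \<le> c \<longleftrightarrow> dN N x y \<le> c \<and> dN M ((T ^^ N) x) ((T ^^ N) y) \<le> c"
proof -
  have "(\<forall>n<N + M. P n) \<longleftrightarrow> (\<forall>n<N. P n) \<and> (\<forall>n<M. P (n + N))" for P
    by (metis add.commute add_less_cancel_right le_Suc_ex not_less trans_less_add1)
  then show ?thesis using assms by (simp add: bowen_le_iff funpow_add)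
qed

lemma bowen_add:
  assumes "1 \<le> N" "1 \<le> M"
  shows "dN (N + M) x y = max (dN N x y) (dN M ((T ^^ N) x) ((T ^^ N) y))"
  using bowen_add_le_iff[OF assms, THEN iffD1, OF order.refl, of x y]
  by (intro order.antisym) (auto simp: bowen_add_le_iff[OF assms])

text \<open>
  Covers for \<open>dN N\<close> and \<open>dN M\<close> are combined by intersecting the sets of the first with preimages
  under \<open>T ^^ N\<close> of the sets of the second. Such an intersection is open for \<open>dN (N + M)\<close>, because
  this metric is the maximum of \<open>dN N\<close> and of the pullback of \<open>dN M\<close> under \<open>T ^^ N\<close>.
\<close>
lemma finite_open_cover_bowen_add:
  assumes N: "1 \<le> N" "1 \<le> M"
    and cov: "finite_open_cover X (dN N) \<epsilon> n" "finite_open_cover X (dN M) \<epsilon> k"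
  shows "finite_open_cover X (dN (N + M)) \<epsilon> (n * k)"
proof -
  interpret N: bounded_metric X "dN N" using N by (intro bounded_metric_bowen)
  interpret M: bounded_metric X "dN M" using N by (intro bounded_metric_bowen)
  interpret NM: bounded_metric X "dN (N + M)" using N by (intro bounded_metric_bowen) auto
  obtain U where n: "1 \<le> n" and U: "\<And>i. i < n \<Longrightarrow> openin N.mtopology (U i)" "\<And>i. i < n \<Longrightarrow> diam_on (dN N) (U i) < \<epsilon>"
    and XU: "X = (\<Union>i<n. U i)"
    using cov(1) unfolding finite_open_cover_def by blast
  obtain V where k: "1 \<le> k" and V: "\<And>i. i < k \<Longrightarrow> openin M.mtopology (V i)" "\<And>i. i < k \<Longrightarrow> diam_on (dN M) (V i) < \<epsilon>"
    and XV: "X = (\<Union>i<k. V i)"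
    using cov(2) unfolding finite_open_cover_def by blast
  define W where "W j = {x \<in> U (j div k). (T ^^ N) x \<in> V (j mod k)}" for j
  have j: "j div k < n" "j mod k < k" if "j < n * k" for j
    using that k by (auto simp: less_mult_imp_div_less)
  have UX: "U i \<subseteq> X" if "i < n" for i using U(1)[OF that] N.openin_mtopology by blast
  have VX: "V i \<subseteq> X" if "i < k" for i using V(1)[OF that] M.openin_mtopology by blast
  have "openin NM.mtopology (W i)" if i: "i < n * k" for i
    unfolding NM.openin_mtopology
  proof (intro conjI allI impI)
    show "W i \<subseteq> X" using UX j[OF i] unfolding W_def by auto
    fix x assume x: "x \<in> W i"
    obtain r1 where r1: "0 < r1" "N.mball x r1 \<subseteq> U (i div k)"
      using U(1) j(1)[OF i] x unfolding N.openin_mtopology W_def by blast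
    obtain r2 where r2: "0 < r2" "M.mball ((T ^^ N) x) r2 \<subseteq> V (i mod k)"
      using V(1) j(2)[OF i] x unfolding M.openin_mtopology W_def by blast
    have "NM.mball x (min r1 r2) \<subseteq> W i"
    proof
      fix y assume "y \<in> NM.mball x (min r1 r2)"
      then have y: "x \<in> X" "y \<in> X" "dN (N + M) x y < min r1 r2" by auto
      then have "dN N x y < r1" "dN M ((T ^^ N) x) ((T ^^ N) y) < r2"
        unfolding bowen_add[OF N] by auto
      then have "y \<in> N.mball x r1" "(T ^^ N) y \<in> M.mball ((T ^^ N) x) r2"
        using y funpow_invariant by auto
      then show "y \<in> W i" using r1 r2 unfolding W_def by auto
    qed
    then show "\<exists>r>0. NM.mball x r \<subseteq> W i" using r1(1) r2(1) by (intro exI[of _ "min r1 r2"]) auto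
  qed
  moreover have "diam_on (dN (N + M)) (W i) < \<epsilon>" if i: "i < n * k" for i
  proof -
    have "diam_on (dN (N + M)) (W i) \<le> max (diam_on (dN N) (U (i div k))) (diam_on (dN M) (V (i mod k)))"
    proof (rule NM.diam_on_le)
      show "0 \<le> max (diam_on (dN N) (U (i div k))) (diam_on (dN M) (V (i mod k)))"
        using N.diam_on_nonneg[OF UX] j[OF i] by (simp add: le_max_iff_disj)
      fix x y assume "x \<in> W i" "y \<in> W i"
      then show "dN (N + M) x y \<le> max (diam_on (dN N) (U (i div k))) (diam_on (dN M) (V (i mod k)))"
        unfolding bowen_add[OF N] using j[OF i] UX VX
        by (intro max.mono N.diam_on_ge M.diam_on_ge) (auto simp: W_def)
    qed
    also have "\<dots> < \<epsilon>" using U(2) V(2) j[OF i] by simp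
    finally show ?thesis .
  qed
  moreover have "X = (\<Union>i<n * k. W i)"
  proof
    show "X \<subseteq> (\<Union>i<n * k. W i)"
    proof
      fix x assume x: "x \<in> X"
      obtain a where a: "a < n" "x \<in> U a" using x XU by auto
      obtain b where b: "b < k" "(T ^^ N) x \<in> V b" using funpow_invariant[OF x, of N] XV by auto
      have "a * k + b < (a + 1) * k" using b by simp
      also have "\<dots> \<le> n * k" using a by (intro mult_right_mono) auto
      finally have "a * k + b < n * k" .
      moreover have "x \<in> W (a * k + b)" using a b by (simp add: W_def)
      ultimately show "x \<in> (\<Union>i<n * k. W i)" by blast
    qed
    show "(\<Union>i<n * k. W i) \<subseteq> X" using UX j unfolding W_def by blast
  qed
  moreover have "1 \<le> n * k" using n k by (simp add: Suc_le_eq)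
  ultimately show ?thesis unfolding finite_open_cover_def by blast
qed

context
  assumes cov: "\<And>N \<epsilon>. 1 \<le> N \<Longrightarrow> 0 < \<epsilon> \<Longrightarrow> \<exists>n. finite_open_cover X (dN N) \<epsilon> n"
begin

lemma cover_num_pos:
  assumes "1 \<le> N" "0 < \<epsilon>"
  shows "1 \<le> cover_num X (dN N) \<epsilon>"
proof -
  obtain n where "finite_open_cover X (dN N) \<epsilon> n" using cov[OF assms] ..
  from finite_open_cover_cover_num[OF this] show ?thesis by (simp add: finite_open_cover_def)
qed

lemma cover_entropy_exists:
  assumes "0 < \<epsilon>"
  shows "\<exists>e. (\<lambda>N. ln (real (cover_num X (dN N) \<epsilon>)) / real N) \<longlonglongrightarrow> e"
proof (rule fekete)
  fix i j :: nat assume ij: "1 \<le> i" "1 \<le> j"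
  obtain n k where "finite_open_cover X (dN i) \<epsilon> n" "finite_open_cover X (dN j) \<epsilon> k"
    using cov ij assms by blast
  then have "finite_open_cover X (dN (i + j)) \<epsilon> (cover_num X (dN i) \<epsilon> * cover_num X (dN j) \<epsilon>)"
    by (intro finite_open_cover_bowen_add ij finite_open_cover_cover_num)
  then have le: "cover_num X (dN (i + j)) \<epsilon> \<le> cover_num X (dN i) \<epsilon> * cover_num X (dN j) \<epsilon>"
    by (rule cover_num_le)
  have p: "1 \<le> cover_num X (dN (i + j)) \<epsilon>" "1 \<le> cover_num X (dN i) \<epsilon>" "1 \<le> cover_num X (dN j) \<epsilon>"
    using ij assms by (auto intro!: cover_num_pos[simplified])
  then show "ln (real (cover_num X (dN (i + j)) \<epsilon>))
      \<le> ln (real (cover_num X (dN i) \<epsilon>)) + ln (real (cover_num X (dN j) \<epsilon>))"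
    using le by (subst ln_mult_pos[symmetric]) (auto simp flip: of_nat_mult)
next
  fix i show "0 \<le> ln (real (cover_num X (dN i) \<epsilon>))"
    by (cases "cover_num X (dN i) \<epsilon>") auto
qed

text \<open>
  By the first estimate the covering entropy at scale \<open>\<epsilon>\<close> is at most \<open>D * ln (B / \<epsilon>)\<close>, by the
  second one and the mass distribution principle at least \<open>D * ln (1 / \<epsilon>) - C\<close>; after division by
  \<open>ln (1 / \<epsilon>)\<close> the constants vanish in the limit. It matters that \<open>B\<close> and \<open>C\<close> depend neither on
  \<open>\<epsilon>\<close> nor on \<open>\<delta>\<close>. For the Hausdorff version the same measure gives dimension at least
  \<open>N * (D - 2 * \<delta>)\<close> at all scales below a bound independent of \<open>N\<close>.
\<close>
theorem mean_dimensions_eq: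
  assumes B: "1 \<le> B"
    and upper: "\<And>\<epsilon> \<delta>. 0 < \<epsilon> \<Longrightarrow> \<epsilon> < 1 \<Longrightarrow> 0 < \<delta> \<Longrightarrow>
      \<forall>\<^sub>F N in sequentially. ln (real (cover_num X (dN N) \<epsilon>)) \<le> real N * ((D + \<delta>) * ln (B / \<epsilon>))"
    and lower: "\<And>\<delta>. 0 < \<delta> \<Longrightarrow>
      \<forall>\<^sub>F N in sequentially. \<exists>(M :: 'b measure) \<Phi>. frostman X (dN N) M \<Phi> (exp (real N * C)) (real N * (D - \<delta>))"
  shows "lower_mdim_H X T d = ereal D \<and> upper_mdim_H X T d = ereal D \<and>
         lower_mdim_M X T d = ereal D \<and> upper_mdim_M X T d = ereal D"
proof -
  define e where "e \<epsilon> = lim (\<lambda>N. ln (real (cover_num X (dN N) \<epsilon>)) / real N)" for \<epsilon>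
  have e: "(\<lambda>N. ln (real (cover_num X (dN N) \<epsilon>)) / real N) \<longlonglongrightarrow> e \<epsilon>" if "0 < \<epsilon>" for \<epsilon>
    using cover_entropy_exists[OF that] limI unfolding e_def by blast
  have e_le: "e \<epsilon> \<le> D * ln (B / \<epsilon>)" if \<epsilon>: "0 < \<epsilon>" "\<epsilon> < 1" for \<epsilon>
  proof (rule field_le_epsilon)
    fix \<eta> :: real assume \<eta>: "0 < \<eta>"
    have l: "0 < ln (B / \<epsilon>)" using B \<epsilon> by simp
    then have pos: "0 < \<eta> / ln (B / \<epsilon>)" using \<eta> by simp
    have "\<forall>\<^sub>F N in sequentially. ln (real (cover_num X (dN N) \<epsilon>)) / real N \<le> D * ln (B / \<epsilon>) + \<eta>"
      using upper[OF \<epsilon> pos] eventually_ge_at_top[of 1]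
    proof eventually_elim
      case (elim N)
      have "(D + \<eta> / ln (B / \<epsilon>)) * ln (B / \<epsilon>) = D * ln (B / \<epsilon>) + \<eta>"
        using l by (simp add: distrib_right)
      then show ?case using elim by (simp add: pos_divide_le_eq mult.commute)
    qed
    from tendsto_upperbound[OF e[OF \<epsilon>(1)] this] show "e \<epsilon> \<le> D * ln (B / \<epsilon>) + \<eta>" by simp
  qed
  have e_ge: "D * ln (1 / \<epsilon>) - C \<le> e \<epsilon>" if \<epsilon>: "0 < \<epsilon>" "\<epsilon> < 1" for \<epsilon>
  proof (rule field_le_epsilon)
    fix \<eta> :: real assume \<eta>: "0 < \<eta>"
    have l: "0 < ln (1 / \<epsilon>)" using \<epsilon> by simp
    then have pos: "0 < \<eta> / ln (1 / \<epsilon>)" using \<eta> by simp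
    have "\<forall>\<^sub>F N in sequentially. D * ln (1 / \<epsilon>) - C - \<eta> \<le> ln (real (cover_num X (dN N) \<epsilon>)) / real N"
      using lower[OF pos] eventually_ge_at_top[of 1]
    proof eventually_elim
      case (elim N)
      then obtain M :: "'b measure" and \<Phi>
        where fr: "frostman X (dN N) M \<Phi> (exp (real N * C)) (real N * (D - \<eta> / ln (1 / \<epsilon>)))" by blast
      interpret N: bounded_metric X "dN N" using elim by (intro bounded_metric_bowen)
      obtain n where n: "finite_open_cover X (dN N) \<epsilon> n" using cov elim \<epsilon> by blast
      define c where "c = real (cover_num X (dN N) \<epsilon>)"
      define p where "p = exp (real N * C) * \<epsilon> powr (real N * (D - \<eta> / ln (1 / \<epsilon>)))"
      have "1 \<le> c * p"
        using N.cover_num_ge_frostman[OF fr n] \<epsilon> by (simp add: c_def p_def)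
      moreover have "0 < c" using cover_num_pos[of N \<epsilon>] elim \<epsilon> by (simp add: c_def)
      moreover have "0 < p" using \<epsilon> by (simp add: p_def)
      ultimately have "0 \<le> ln c + ln p" by (subst ln_mult_pos[symmetric]) auto
      also have "ln p = real N * C + real N * (D - \<eta> / ln (1 / \<epsilon>)) * ln \<epsilon>"
        unfolding p_def using \<epsilon> by (subst ln_mult_pos) (auto simp: ln_powr)
      also have "\<dots> = real N * (C - D * ln (1 / \<epsilon>) + \<eta>)"
        using \<epsilon> l by (simp add: ln_div field_simps)
      finally show ?case using elim by (simp add: c_def field_simps)
    qed
    from tendsto_lowerbound[OF e[OF \<epsilon>(1)] this] show "D * ln (1 / \<epsilon>) - C \<le> e \<epsilon> + \<eta>" by simp
  qed
  have ratio: "(\<lambda>N. ereal (ln (real (cover_num X (dN N) \<epsilon>)) / (real N * ln (1 / \<epsilon>))))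
      \<longlonglongrightarrow> ereal (e \<epsilon> / ln (1 / \<epsilon>))" if "0 < \<epsilon>" "\<epsilon> < 1" for \<epsilon>
    using tendsto_divide[OF e[OF that(1)] tendsto_const[of "ln (1 / \<epsilon>)"]] that
    by (intro tendsto_ereal) simp
  have small: "\<forall>\<^sub>F \<epsilon> in at_right 0. 0 < \<epsilon> \<and> \<epsilon> < a" if "0 < a" for a :: real
    using that unfolding eventually_at_right_field by auto
  have at_top: "filterlim (\<lambda>\<epsilon>. ln (1 / \<epsilon>)) at_top (at_right (0 :: real))"
  proof -
    have "filterlim (\<lambda>\<epsilon>. - ln \<epsilon>) at_top (at_right (0 :: real))"
      using ln_at_0 by (simp add: filterlim_uminus_at_top)
    moreover have ev: "\<forall>\<^sub>F \<epsilon> in at_right (0 :: real). - ln \<epsilon> = ln (1 / \<epsilon>)"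
      using small[OF zero_less_one] by eventually_elim (auto simp: ln_div)
    ultimately show ?thesis using filterlim_cong[OF refl refl ev] by blast
  qed
  have const0: "((\<lambda>\<epsilon>. c / ln (1 / \<epsilon>)) \<longlongrightarrow> 0) (at_right 0)" for c :: real
    using at_top by (intro tendsto_divide_0[OF tendsto_const] filterlim_at_top_imp_at_infinity)
  have e_lim: "((\<lambda>\<epsilon>. e \<epsilon> / ln (1 / \<epsilon>)) \<longlongrightarrow> D) (at_right 0)"
  proof (rule tendsto_sandwich)
    show "\<forall>\<^sub>F \<epsilon> in at_right 0. D - C / ln (1 / \<epsilon>) \<le> e \<epsilon> / ln (1 / \<epsilon>)"
    proof -
      have "D - C / ln (1 / \<epsilon>) \<le> e \<epsilon> / ln (1 / \<epsilon>)" if \<epsilon>: "0 < \<epsilon>" "\<epsilon> < 1" for \<epsilon>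
      proof -
        have "0 < ln (1 / \<epsilon>)" using \<epsilon> by simp
        then have "D - C / ln (1 / \<epsilon>) = (D * ln (1 / \<epsilon>) - C) / ln (1 / \<epsilon>)"
          by (simp add: diff_divide_distrib)
        also have "\<dots> \<le> e \<epsilon> / ln (1 / \<epsilon>)"
          using e_ge[OF \<epsilon>] \<open>0 < ln (1 / \<epsilon>)\<close> by (intro divide_right_mono) auto
        finally show ?thesis .
      qed
      then show ?thesis by (intro eventually_mono[OF small[OF zero_less_one]]) auto
    qed
    show "\<forall>\<^sub>F \<epsilon> in at_right 0. e \<epsilon> / ln (1 / \<epsilon>) \<le> D + D * ln B / ln (1 / \<epsilon>)"
    proof -
      have "e \<epsilon> / ln (1 / \<epsilon>) \<le> D + D * ln B / ln (1 / \<epsilon>)" if \<epsilon>: "0 < \<epsilon>" "\<epsilon> < 1" for \<epsilon>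
      proof -
        have "e \<epsilon> \<le> D * ln B + D * ln (1 / \<epsilon>)"
          using e_le[OF \<epsilon>] B \<epsilon> by (simp add: ln_div algebra_simps)
        then have "e \<epsilon> / ln (1 / \<epsilon>) \<le> (D * ln B + D * ln (1 / \<epsilon>)) / ln (1 / \<epsilon>)"
          using \<epsilon> by (intro divide_right_mono) auto
        moreover have "0 < ln (1 / \<epsilon>)" using \<epsilon> by simp
        ultimately show ?thesis by (simp add: add_divide_distrib)
      qed
      then show ?thesis by (intro eventually_mono[OF small[OF zero_less_one]]) auto
    qed
    show "((\<lambda>\<epsilon>. D - C / ln (1 / \<epsilon>)) \<longlongrightarrow> D) (at_right 0)"
      using tendsto_diff[OF tendsto_const const0] by fastforce
    show "((\<lambda>\<epsilon>. D + D * ln B / ln (1 / \<epsilon>)) \<longlongrightarrow> D) (at_right 0)"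
      using tendsto_add[OF tendsto_const const0] by fastforce
  qed
  have "\<forall>\<^sub>F \<epsilon> in at_right 0. ereal (e \<epsilon> / ln (1 / \<epsilon>)) = entropy_ratio X T d \<epsilon>"
    by (intro eventually_mono[OF small[OF zero_less_one]])
      (auto simp: entropy_ratio_def limI[OF ratio])
  then have M: "(entropy_ratio X T d \<longlongrightarrow> ereal D) (at_right 0)"
    using tendsto_cong[THEN iffD1, OF _ tendsto_ereal[OF e_lim]] by blast
  define up where "up \<epsilon> = limsup (\<lambda>N. dim_H X (dN N) \<epsilon> / ereal (real N))" for \<epsilon>
  define lo where "lo \<epsilon> = liminf (\<lambda>N. dim_H X (dN N) \<epsilon> / ereal (real N))" for \<epsilon>
  have lo_up: "lo \<epsilon> \<le> up \<epsilon>" for \<epsilon> unfolding lo_def up_def by (rule Liminf_le_Limsup) simp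
  have up_le: "up \<epsilon> \<le> ereal D" if "0 < \<epsilon>" for \<epsilon>
  proof (rule tendsto_lowerbound[OF tendsto_ereal[OF e_lim]])
    have "up \<epsilon> \<le> ereal (e \<epsilon>' / ln (1 / \<epsilon>'))" if \<epsilon>': "0 < \<epsilon>'" "\<epsilon>' < 1" "\<epsilon>' \<le> \<epsilon>" for \<epsilon>'
    proof -
      have "up \<epsilon> \<le> limsup (\<lambda>N. ereal (ln (real (cover_num X (dN N) \<epsilon>')) / (real N * ln (1 / \<epsilon>'))))"
        unfolding up_def
      proof (rule Limsup_mono)
        show "\<forall>\<^sub>F N in sequentially. dim_H X (dN N) \<epsilon> / ereal (real N)
            \<le> ereal (ln (real (cover_num X (dN N) \<epsilon>')) / (real N * ln (1 / \<epsilon>')))"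
          using eventually_ge_at_top[of 1]
        proof eventually_elim
          case (elim N)
          interpret N: bounded_metric X "dN N" using elim by (intro bounded_metric_bowen)
          obtain n where n: "finite_open_cover X (dN N) \<epsilon>' n" using cov elim \<epsilon>' by blast
          have "dim_H X (dN N) \<epsilon> / ereal (real N)
              \<le> ereal (ln (real (cover_num X (dN N) \<epsilon>')) / ln (1 / \<epsilon>')) / ereal (real N)"
            using N.dim_H_le_cover_num[OF n \<epsilon>'] elim by (intro ereal_divide_right_mono) auto
          then show ?case using elim by (simp add: mult.commute)
        qed
      qed
      also have "\<dots> = ereal (e \<epsilon>' / ln (1 / \<epsilon>'))"
        using ratio \<epsilon>' by (intro lim_imp_Limsup) auto
      finally show ?thesis .
    qed
    then show "\<forall>\<^sub>F \<epsilon>' in at_right 0. up \<epsilon> \<le> ereal (e \<epsilon>' / ln (1 / \<epsilon>'))"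
      using \<open>0 < \<epsilon>\<close> by (intro eventually_mono[OF small[of "min 1 \<epsilon>"]]) auto
  qed simp
  have lo_ge: "\<forall>\<^sub>F \<epsilon> in at_right 0. ereal (D - 2 * \<delta>) \<le> lo \<epsilon>" if \<delta>: "0 < \<delta>" for \<delta>
  proof (cases "0 < D - 2 * \<delta>")
    case False
    have "0 \<le> lo \<epsilon>" for \<epsilon>
      unfolding lo_def
    proof (rule Liminf_bounded)
      show "\<forall>\<^sub>F N in sequentially. 0 \<le> dim_H X (dN N) \<epsilon> / ereal (real N)"
        using eventually_ge_at_top[of 1]
      proof eventually_elim
        case (elim N)
        interpret N: bounded_metric X "dN N" using elim by (intro bounded_metric_bowen)
        show ?case using N.dim_H_nonneg elim by simp
      qed
    qed
    moreover have "ereal (D - 2 * \<delta>) \<le> 0" using False by simp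
    ultimately show ?thesis using order_trans by (intro always_eventually) blast
  next
    case True
    have "((\<lambda>\<epsilon>. exp C * 2 powr (D - \<delta>) * \<epsilon> powr \<delta>) \<longlongrightarrow> exp C * 2 powr (D - \<delta>) * 0 powr \<delta>) (at_right 0)"
      using \<delta> by (intro tendsto_mult_left tendsto_powr') (auto simp: eventually_at_right_field intro!: exI[of _ 1])
    then have "\<forall>\<^sub>F \<epsilon> in at_right 0. exp C * 2 powr (D - \<delta>) * \<epsilon> powr \<delta> < 1"
      using \<delta> by (intro order_tendstoD) auto
    moreover have "\<forall>\<^sub>F \<epsilon> in at_right 0. 0 < \<epsilon> \<and> \<epsilon> < (1/2 :: real)" by (intro small) simp
    ultimately show ?thesis
    proof eventually_elim
      case (elim \<epsilon>)
      have "\<forall>\<^sub>F N in sequentially. ereal (D - 2 * \<delta>) \<le> dim_H X (dN N) \<epsilon> / ereal (real N)"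
        using lower[OF \<delta>] eventually_ge_at_top[of 1]
      proof eventually_elim
        case N: (elim N)
        then obtain M :: "'b measure" and \<Phi>
          where fr: "frostman X (dN N) M \<Phi> (exp (real N * C)) (real N * (D - \<delta>))" by blast
        interpret N: bounded_metric X "dN N" using N by (intro bounded_metric_bowen)
        \<comment> \<open>The smallness condition on \<open>\<epsilon>\<close> is the \<open>N\<close>-th power of one that does not involve \<open>N\<close>.\<close>
        have "exp (real N * C) * 2 powr (real N * (D - \<delta>)) * \<epsilon> powr (real N * (D - \<delta>) - real N * (D - 2 * \<delta>))
          = (exp C * 2 powr (D - \<delta>) * \<epsilon> powr \<delta>) ^ N"
        proof -
          have "real N * (D - \<delta>) - real N * (D - 2 * \<delta>) = real N * \<delta>" by (simp add: algebra_simps)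
          then show ?thesis using elim by (simp add: power_mult_distrib exp_of_nat_mult powr_power)
        qed
        also have "\<dots> \<le> 1" using elim by (intro power_le_one) auto
        finally have "ereal (real N * (D - 2 * \<delta>)) \<le> dim_H X (dN N) \<epsilon>"
          using N True \<delta> elim by (intro N.dim_H_ge_frostman[OF fr]) auto
        then have "ereal (real N * (D - 2 * \<delta>)) / ereal (real N) \<le> dim_H X (dN N) \<epsilon> / ereal (real N)"
          using N by (intro ereal_divide_right_mono) auto
        then show ?case using N by simp
      qed
      then show ?case unfolding lo_def by (rule Liminf_bounded)
    qed
  qed
  have H: "(F \<longlongrightarrow> ereal D) (at_right 0)" if F: "\<And>\<epsilon>. lo \<epsilon> \<le> F \<epsilon>" "\<And>\<epsilon>. F \<epsilon> \<le> up \<epsilon>" for F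
  proof (rule order_tendstoI)
    fix a assume "a < ereal D"
    then obtain z where z: "a < ereal z" "ereal z < ereal D" using ereal_dense2 by blast
    have "D - 2 * ((D - z) / 2) = z" by (simp add: field_simps)
    moreover have "0 < (D - z) / 2" using z by simp
    ultimately have "\<forall>\<^sub>F \<epsilon> in at_right 0. ereal z \<le> lo \<epsilon>"
      using lo_ge[of "(D - z) / 2"] by metis
    then show "\<forall>\<^sub>F \<epsilon> in at_right 0. a < F \<epsilon>"
      by eventually_elim (use z F(1) less_le_trans in blast)
  next
    fix a assume "ereal D < a"
    then show "\<forall>\<^sub>F \<epsilon> in at_right 0. F \<epsilon> < a"
      by (intro eventually_mono[OF small[OF zero_less_one]])
        (meson F(2) up_le le_less_trans)
  qed
  have "Lim (at_right 0) up = ereal D" "Lim (at_right 0) lo = ereal D"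
    using lo_up by (auto intro!: tendsto_Lim H)
  moreover have "Limsup (at_right 0) (entropy_ratio X T d) = ereal D"
    "Liminf (at_right 0) (entropy_ratio X T d) = ereal D"
    using M by (auto intro!: lim_imp_Limsup lim_imp_Liminf)
  ultimately show ?thesis
    unfolding upper_mdim_H_def lower_mdim_H_def upper_mdim_M_def lower_mdim_M_def up_def lo_def by simp
qed

end

end

section \<open>Words and their fibers\<close>
definition word :: "nat \<Rightarrow> nat \<Rightarrow> (nat \<Rightarrow> nat \<Rightarrow> nat) \<Rightarrow> nat \<Rightarrow> nat \<Rightarrow> nat" where
  "word i N x = restrict (proj i x) {..<N}"

text \<open>
  The counterpart on words of forgetting the coordinates after the \<open>i\<close>-th: it induces
  \<open>proj_words j \<Omega> N \<rightarrow> proj_words i \<Omega> N\<close> for \<open>i \<le> j\<close>, and is \<open>tau_word\<close> up to indexing.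
\<close>
definition project_word :: "nat \<Rightarrow> nat \<Rightarrow> (nat \<Rightarrow> nat \<Rightarrow> nat) \<Rightarrow> nat \<Rightarrow> nat \<Rightarrow> nat" where
  "project_word i N u = (\<lambda>n\<in>{..<N}. restrict (u n) {1..i})"

lemma word_eq_iff: "word i N x = word i N y \<longleftrightarrow> (\<forall>n<N. \<forall>l\<in>{1..i}. x n l = y n l)"
  by (auto simp: word_def Defs.proj_def fun_eq_iff restrict_def)

lemma proj_words_eq: "proj_words i \<Omega> N = word i N ` \<Omega>"
  by (auto simp: proj_words_def word_def)

lemma project_word_word: "i \<le> j \<Longrightarrow> project_word i N (word j N x) = word i N x"
  by (auto simp: project_word_def word_def Defs.proj_def fun_eq_iff)

lemma project_word_proj_words: "i \<le> j \<Longrightarrow> project_word i N ` proj_words j \<Omega> N = proj_words i \<Omega> N"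
  by (auto simp: proj_words_eq image_image project_word_word)

locale sponge_data =
  fixes r :: nat and m :: "nat \<Rightarrow> nat" and \<Omega> :: "(nat \<Rightarrow> nat \<Rightarrow> nat) set"
  assumes r: "1 \<le> r" and m1: "2 \<le> m 1" and mono: "mono_on {1..r} m"
    and subshift: "subshift (alphabet m r) \<Omega>" and \<Omega>_nonempty: "\<Omega> \<noteq> {}"
begin

lemma m_ge_2: "l \<in> {1..r} \<Longrightarrow> 2 \<le> m l"
  using mono_onD[OF mono, of 1 l] m1 r by auto

lemma m_le: "l \<in> {1..r} \<Longrightarrow> l' \<in> {1..r} \<Longrightarrow> l \<le> l' \<Longrightarrow> m l \<le> m l'"
  using mono_onD[OF mono] by auto

lemma digit_less: "x \<in> \<Omega> \<Longrightarrow> l \<in> {1..r} \<Longrightarrow> x n l < m l"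
  using subshift_subset[OF subshift, of x n] by (auto simp: alphabet_def PiE_iff)

lemma funpow_shift: "x \<in> \<Omega> \<Longrightarrow> (\<lambda>n. x (n + N)) \<in> \<Omega>"
proof (induction N)
  case (Suc N)
  then have "seq_shift (\<lambda>n. x (n + N)) \<in> \<Omega>" using subshift by (auto simp: subshift_def)
  then show ?case by (simp add: seq_shift_def)
qed simp

lemma finite_proj_words: 
  assumes "i \<le> r"
  shows "finite (proj_words i \<Omega> N)"
proof (rule finite_subset)
  show "proj_words i \<Omega> N \<subseteq> (\<Pi>\<^sub>E n\<in>{..<N}. \<Pi>\<^sub>E l\<in>{1..i}. {..<m l})"
    using digit_less assms by (auto simp: proj_words_eq word_def Defs.proj_def)
  show "finite (\<Pi>\<^sub>E n\<in>{..<N}. \<Pi>\<^sub>E l\<in>{1..i}. {..<m l})"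
    by (intro finite_PiE) auto
qed

abbreviation C :: "nat \<Rightarrow> nat \<Rightarrow> real" where "C i N \<equiv> real (card (proj_words i \<Omega> N))"

lemma C_pos: "i \<le> r \<Longrightarrow> 1 \<le> C i N"
  using finite_proj_words[of i N] \<Omega>_nonempty
  by (auto simp: Suc_le_eq card_gt_0_iff proj_words_eq)

lemma C_0: "C 0 N = 1"
proof -
  obtain x where "x \<in> \<Omega>" using \<Omega>_nonempty by auto
  then have "proj_words 0 \<Omega> N = {word 0 N x}"
    by (auto simp: proj_words_eq word_eq_iff)
  then show ?thesis by simp
qed

lemma C_mono: "i \<le> j \<Longrightarrow> j \<le> r \<Longrightarrow> C i N \<le> C j N"
  using card_image_le[OF finite_proj_words, of j "project_word i N" N] by (simp add: project_word_proj_words)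

lemma C_submult:
  assumes "i \<le> r"
  shows "C i (N + M) \<le> C i N * C i M"
proof -
  define split where "split u = (restrict u {..<N}, restrict (\<lambda>n. u (n + N)) {..<M})"
    for u :: "nat \<Rightarrow> nat \<Rightarrow> nat"
  have split: "split (word i (N + M) x) = (word i N x, word i M (\<lambda>n. x (n + N)))" for x
    by (auto simp: split_def word_def Defs.proj_def fun_eq_iff)
  have "inj_on split (proj_words i \<Omega> (N + M))"
  proof (rule inj_onI, clarsimp simp: proj_words_eq split word_eq_iff)
    fix x y n l
    assume *: "\<forall>n<N. \<forall>l\<in>{Suc 0..i}. x n l = (y n l :: nat)"
      "\<forall>n<M. \<forall>l\<in>{Suc 0..i}. x (n + N) l = y (n + N) l"
      "n < N + M" "Suc 0 \<le> l" "l \<le> i"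
    show "x n l = y n l"
    proof (cases "n < N")
      case False
      then show ?thesis using *(2)[rule_format, of "n - N" l] *(3-) by simp
    qed (use * in auto)
  qed
  moreover have "split ` proj_words i \<Omega> (N + M) \<subseteq> proj_words i \<Omega> N \<times> proj_words i \<Omega> M"
    using funpow_shift by (auto simp: proj_words_eq split)
  ultimately have "card (proj_words i \<Omega> (N + M)) \<le> card (proj_words i \<Omega> N \<times> proj_words i \<Omega> M)"
    using finite_proj_words[OF assms] by (intro card_inj_on_le) auto
  then show ?thesis by (simp add: card_cartesian_product flip: of_nat_mult)
qed

lemma C_entropy_exists: "i \<le> r \<Longrightarrow> \<exists>h. (\<lambda>N. ln (C i N) / real N) \<longlonglongrightarrow> h"
proof (rule fekete)
  fix N M :: nat assume i: "i \<le> r"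
  have "ln (C i (N + M)) \<le> ln (C i N * C i M)"
    using C_submult[OF i, of N M] C_pos[OF i, of "N + M"] by (intro ln_mono) auto
  also have "\<dots> = ln (C i N) + ln (C i M)"
    using C_pos[OF i, of N] C_pos[OF i, of M] by (intro ln_mult_pos) auto
  finally show "ln (C i (N + M)) \<le> ln (C i N) + ln (C i M)" .
next
  fix N assume i: "i \<le> r"
  then show "0 \<le> ln (C i N)" using C_pos[OF i, of N] by simp
qed

definition words_over :: "nat \<Rightarrow> nat \<Rightarrow> nat \<Rightarrow> (nat \<Rightarrow> nat \<Rightarrow> nat) \<Rightarrow> (nat \<Rightarrow> nat \<Rightarrow> nat) set" where
  "words_over i j N v = {u \<in> proj_words j \<Omega> N. project_word i N u = v}"

lemma words_over_eq: "i \<le> j \<Longrightarrow> words_over i j N v = word j N ` {x \<in> \<Omega>. word i N x = v}"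
  by (auto simp: words_over_def proj_words_eq project_word_word)

lemma card_words_over_sum:
  assumes "i \<le> j" "j \<le> k" "k \<le> r"
  shows "card (words_over i k N v) = (\<Sum>u\<in>words_over i j N v. card (words_over j k N u))"
proof -
  have "project_word j N ` words_over i k N v = words_over i j N v"
    using assms by (auto simp: words_over_eq image_image project_word_word)
  moreover have "{u \<in> words_over i k N v. project_word j N u = w} = words_over j k N w" if "w \<in> words_over i j N v" for w
    using that assms by (auto simp: words_over_def proj_words_eq project_word_word) (metis project_word_word)
  moreover have "finite (words_over i k N v)" using finite_proj_words[OF assms(3)] by (simp add: words_over_def)
  ultimately show ?thesis using sum.image_gen[of "words_over i k N v" "\<lambda>_. 1 :: nat" "project_word j N"] by simp
qed

lemma words_over_self: "v \<in> proj_words i \<Omega> N \<Longrightarrow> words_over i i N v = {v}"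
  by (auto simp: words_over_def proj_words_eq project_word_word)

lemma C_eq_sum_words_over:
  assumes "i \<le> j" "j \<le> r"
  shows "card (proj_words j \<Omega> N) = (\<Sum>v\<in>proj_words i \<Omega> N. card (words_over i j N v))"
  using sum.image_gen[OF finite_proj_words[OF assms(2)], of "\<lambda>_. 1 :: nat" N "project_word i N"] assms
  by (simp add: project_word_proj_words words_over_def)

text \<open>
  All fibers have size between \<open>P N / q ^ N\<close> and \<open>P N * q ^ N\<close>. The lower bound, summed over the
  base, compares \<open>C i N * P N\<close> with \<open>C (Suc i) N\<close>; this eliminates \<open>P N\<close> from the upper bound,
  at the price of a second factor \<open>q ^ N\<close>.
\<close>
lemma eventually_card_words_over_step:
  assumes i: "i < r" and P: "\<And>N. 1 \<le> N \<Longrightarrow> 0 < P N"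
    and lim: "\<And>e. 0 < e \<Longrightarrow> \<forall>\<^sub>F N in sequentially. \<forall>v\<in>proj_words i \<Omega> N.
              \<bar>root N (real (card (words_over i (Suc i) N v)) / P N) - 1\<bar> < e"
    and \<delta>: "0 < \<delta>"
  shows "\<forall>\<^sub>F N in sequentially. \<forall>v\<in>proj_words i \<Omega> N.
           real (card (words_over i (Suc i) N v)) * C i N \<le> exp (real N * \<delta>) * C (Suc i) N"
proof -
  define q where "q = exp (\<delta> / 2)"
  have q: "1 < q" using \<delta> by (simp add: q_def)
  define e where "e = min (q - 1) (1 - 1 / q)"
  have e: "0 < e" using q by (simp add: e_def)
  show ?thesis using lim[OF e] eventually_ge_at_top[of 1]
  proof eventually_elim
    case (elim N)
    then have PN: "0 < P N" using P by simp
    have bd: "P N \<le> q ^ N * real (card (words_over i (Suc i) N v)) \<and> real (card (words_over i (Suc i) N v)) \<le> q ^ N * P N"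
      if v: "v \<in> proj_words i \<Omega> N" for v
    proof -
      define f where "f = real (card (words_over i (Suc i) N v)) / P N"
      define z where "z = root N f"
      have zN: "z ^ N = f" unfolding z_def using elim PN by (intro real_root_pow_pos2) (auto simp: f_def)
      have "\<bar>z - 1\<bar> < e" using elim v by (simp add: z_def f_def)
      then have z: "z \<le> q" "1 / q \<le> z" unfolding e_def by linarith+
      have "(1 / q) ^ N \<le> z ^ N" using z q by (intro power_mono) auto
      moreover have "z ^ N \<le> q ^ N"
      proof (rule power_mono[OF z(1)])
        have "0 < 1 / q" using q by simp
        then show "0 \<le> z" using z(2) by linarith
      qed
      ultimately have "1 / q ^ N \<le> f" "f \<le> q ^ N" using zN by (auto simp: power_one_over)
      then show ?thesis using PN q by (simp add: f_def field_simps)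
    qed
    show ?case
    proof
      fix v assume v: "v \<in> proj_words i \<Omega> N"
      have "C i N * P N = (\<Sum>w\<in>proj_words i \<Omega> N. P N)" by simp
      also have "\<dots> \<le> (\<Sum>w\<in>proj_words i \<Omega> N. q ^ N * real (card (words_over i (Suc i) N w)))"
        using bd by (intro sum_mono) auto
      also have "\<dots> = q ^ N * C (Suc i) N"
        using i by (subst C_eq_sum_words_over[of i]) (auto simp: sum_distrib_left)
      finally have *: "C i N * P N \<le> q ^ N * C (Suc i) N" .
      have "real (card (words_over i (Suc i) N v)) * C i N \<le> q ^ N * P N * C i N"
        using bd[OF v] by (intro mult_right_mono) auto
      also have "\<dots> = q ^ N * (C i N * P N)" by simp
      also have "\<dots> \<le> q ^ N * (q ^ N * C (Suc i) N)" using * q by (intro mult_left_mono) auto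
      also have "\<dots> = exp (real N * \<delta>) * C (Suc i) N"
      proof -
        have "q ^ N * q ^ N = exp (real N * \<delta>)"
          by (simp add: q_def flip: exp_of_nat_mult exp_add)
        then show ?thesis by (metis mult.assoc)
      qed
      finally show "real (card (words_over i (Suc i) N v)) * C i N \<le> exp (real N * \<delta>) * C (Suc i) N" .
    qed
  qed
qed

definition uniform_fibers :: bool where
  "uniform_fibers \<longleftrightarrow> (\<forall>i\<in>{1..r - 1}. \<exists>P :: nat \<Rightarrow> real. (\<forall>N\<ge>1. 0 < P N) \<and>
           (\<forall>e>0. \<forall>\<^sub>F N in sequentially. \<forall>v\<in>proj_words (r - i) \<Omega> N.
              \<bar>root N (real (card (tau_fiber r \<Omega> i N v)) / P N) - 1\<bar> < e))"

text \<open>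
  The uniform distribution on the words of \<open>\<Omega>\<close> gives the word \<open>v\<close> of the projection the mass
  \<open>card (words_over i r N v) / C r N\<close>, so this is the almost uniformity of the projected
  distributions. A fiber over level \<open>i\<close> is a disjoint union, over one step, of fibers over level
  \<open>Suc i\<close>, and the errors of the single steps multiply.
\<close>
lemma eventually_card_words_over:
  assumes unif: uniform_fibers and i: "1 \<le> i" "i \<le> r" and \<delta>: "0 < \<delta>"
  shows "\<forall>\<^sub>F N in sequentially. \<forall>v\<in>proj_words i \<Omega> N.
           real (card (words_over i r N v)) * C i N \<le> exp (real N * \<delta>) * C r N"
  using i(2,1) \<delta>
proof (induction i arbitrary: \<delta> rule: inc_induct)
  case base
  show ?case
  proof (intro always_eventually allI ballI)
    fix N v assume "v \<in> proj_words r \<Omega> N"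
    moreover have "1 * C r N \<le> exp (real N * \<delta>) * C r N"
      using base.prems by (intro mult_right_mono) auto
    ultimately show "real (card (words_over r r N v)) * C r N \<le> exp (real N * \<delta>) * C r N"
      by (simp add: words_over_self)
  qed
next
  case (step i)
  have "r - i \<in> {1..r - 1}" using step by auto
  moreover have "tau_fiber r \<Omega> (r - i) N v = words_over i (Suc i) N v" for N v
    using step(2) by (auto simp: tau_fiber_def words_over_def tau_word_def project_word_def)
  ultimately obtain P where P: "\<forall>N\<ge>1. 0 < P N" "\<forall>e>0. \<forall>\<^sub>F N in sequentially. \<forall>v\<in>proj_words i \<Omega> N.
              \<bar>root N (real (card (words_over i (Suc i) N v)) / P N) - 1\<bar> < e"
    using bspec[OF unif[unfolded uniform_fibers_def], of "r - i"] step(2) by (auto simp: less_imp_le)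
  have "\<forall>\<^sub>F N in sequentially. \<forall>v\<in>proj_words i \<Omega> N.
           real (card (words_over i (Suc i) N v)) * C i N \<le> exp (real N * (\<delta> / 2)) * C (Suc i) N"
    by (rule eventually_card_words_over_step[where P = P]) (use step P in auto)
  moreover have "\<forall>\<^sub>F N in sequentially. \<forall>v\<in>proj_words (Suc i) \<Omega> N.
           real (card (words_over (Suc i) r N v)) * C (Suc i) N \<le> exp (real N * (\<delta> / 2)) * C r N"
    by (rule step.IH) (use step in auto)
  ultimately show ?case
  proof eventually_elim
    case (elim N)
    show ?case
    proof
      fix v assume v: "v \<in> proj_words i \<Omega> N"
      define q where "q = exp (real N * (\<delta> / 2))"
      have Cp: "0 < C (Suc i) N" using C_pos[of "Suc i" N] step(2) by linarith
      have "real (card (words_over i r N v)) = (\<Sum>u\<in>words_over i (Suc i) N v. real (card (words_over (Suc i) r N u)))"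
        using step(2) by (subst card_words_over_sum[of i "Suc i"]) auto
      also have "\<dots> \<le> (\<Sum>u\<in>words_over i (Suc i) N v. q * C r N / C (Suc i) N)"
        using elim(2) Cp by (intro sum_mono) (auto simp: words_over_def q_def pos_le_divide_eq)
      also have "\<dots> = real (card (words_over i (Suc i) N v)) * (q * C r N / C (Suc i) N)" by simp
      finally have "real (card (words_over i r N v)) * C i N
          \<le> (real (card (words_over i (Suc i) N v)) * (q * C r N / C (Suc i) N)) * C i N"
        by (rule mult_right_mono) simp
      also have "\<dots> = (real (card (words_over i (Suc i) N v)) * C i N) * (q * C r N / C (Suc i) N)" by simp
      also have "\<dots> \<le> (q * C (Suc i) N) * (q * C r N / C (Suc i) N)"
        using elim(1) v Cp by (intro mult_right_mono) (auto simp: q_def)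
      also have "\<dots> = q * q * C r N" using Cp by simp
      also have "q * q = exp (real N * \<delta>)" by (simp add: q_def flip: exp_add)
      finally show "real (card (words_over i r N v)) * C i N \<le> exp (real N * \<delta>) * C r N" .
    qed
  qed
qed

end

section \<open>Digit expansions\<close>

text \<open>
  The integer with the base \<open>b\<close> digits \<open>u 0, \<dots>, u (L - 1)\<close>, the most significant first. Working with
  this integer rather than with the digits reduces "close points lie in neighbouring cylinders" to
  an inequality between integers.
\<close>
primrec leading :: "nat \<Rightarrow> (nat \<Rightarrow> nat) \<Rightarrow> nat \<Rightarrow> nat" where
  "leading b u 0 = 0"
| "leading b u (Suc L) = leading b u L * b + u L"

lemma leading_eqD:
  assumes "\<And>k. u k < b" "\<And>k. u' k < b" "leading b u L = leading b u' L" "k < L"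
  shows "u k = u' k"
  using assms(3,4)
proof (induction L)
  case (Suc L)
  have "(leading b u L * b + u L) div b = (leading b u' L * b + u' L) div b"
    "(leading b u L * b + u L) mod b = (leading b u' L * b + u' L) mod b"
    using Suc.prems by simp_all
  moreover have "u L < b" "u' L < b" using assms by auto
  moreover then have "b \<noteq> 0" by simp
  ultimately have "leading b u L = leading b u' L" "u L = u' L" by simp_all
  then show ?case using Suc by (cases "k = L") auto
qed simp

lemma leading_cong: "(\<And>k. k < L \<Longrightarrow> u k = u' k) \<Longrightarrow> leading b u L = leading b u' L"
  by (induction L) auto

lemma expansion_bounds:
  assumes b: "2 \<le> b" and u: "\<And>k. u k < b"
    and z: "(\<lambda>k. real (u k) / real b ^ Suc k) sums z"
  shows "real (leading b u L) / real b ^ L \<le> z" "z \<le> (real (leading b u L) + 1) / real b ^ L"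
proof -
  let ?f = "\<lambda>k. real (u k) / real b ^ Suc k"
  have part: "(\<Sum>k<L. ?f k) = real (leading b u L) / real b ^ L"
  proof (induction L)
    case (Suc L)
    then show ?case using b by (simp add: field_simps)
  qed simp
  have tail: "(\<lambda>k. ?f (k + L)) sums (z - real (leading b u L) / real b ^ L)"
    using z part sums_iff_shift[of ?f L] by simp
  have "0 \<le> z - real (leading b u L) / real b ^ L"
    by (rule sums_le[OF _ sums_zero tail]) simp
  then show "real (leading b u L) / real b ^ L \<le> z" by simp
  have "(\<lambda>k. (1 / real b) ^ k) sums (1 / (1 - 1 / real b))"
    using b by (intro geometric_sums) auto
  then have "(\<lambda>k. (real b - 1) / real b ^ Suc L * (1 / real b) ^ k)
               sums ((real b - 1) / real b ^ Suc L * (1 / (1 - 1 / real b)))"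
    by (rule sums_mult)
  also have "(real b - 1) / real b ^ Suc L * (1 / (1 - 1 / real b)) = 1 / real b ^ L"
    using b by (simp add: field_simps)
  finally have g: "(\<lambda>k. (real b - 1) / real b ^ Suc L * (1 / real b) ^ k) sums (1 / real b ^ L)" .
  have "?f (k + L) \<le> (real b - 1) / real b ^ Suc L * (1 / real b) ^ k" for k
  proof -
    have "real (u (k + L)) \<le> real b - 1" using u[of "k + L"] by linarith
    then show ?thesis using b by (simp add: field_simps power_divide power_add)
  qed
  from sums_le[OF this tail g] show "z \<le> (real (leading b u L) + 1) / real b ^ L"
    by (simp add: add_divide_distrib)
qed

section \<open>The sponge as a bounded system\<close>

text \<open>The coordinates from \<open>K\<close> on have total weight \<open>(1/2) ^ K\<close> in the metric.\<close>
lemma sponge_dist_le: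
  assumes "1 \<le> r" "x \<in> cube_space r" "y \<in> cube_space r" "0 \<le> \<rho>"
    and close: "\<And>l k. l \<in> {1..r} \<Longrightarrow> k < K \<Longrightarrow> \<bar>x l k - y l k\<bar> \<le> \<rho>"
  shows "sponge_dist r x y \<le> \<rho> + (1/2) ^ K"
proof (rule sums_le[OF _ sponge_dist_sums[OF assms(1-3)] sums_add])
  show "(\<lambda>k. (1/2) ^ Suc k * \<rho>) sums \<rho>"
    using sums_mult2[OF power_half_series, of \<rho>] by simp
  have "(\<lambda>k. (1/2) ^ K * (1/2) ^ Suc k) sums ((1/2) ^ K * (1 :: real))"
    by (rule sums_mult[OF power_half_series])
  then have "(\<lambda>k. if k + K < K then 0 else (1/2) ^ Suc (k + K)) sums ((1/2) ^ K :: real)"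
    by (simp add: power_add mult.commute)
  then show "(\<lambda>k. if k < K then 0 else (1/2) ^ Suc k) sums ((1/2) ^ K :: real)"
    by (subst (asm) sums_iff_shift) simp
  fix k
  have in01: "x l k \<in> {0..1}" "y l k \<in> {0..1}" if "l \<in> {1..r}" for l
    using assms(2,3) that unfolding cube_space_def by (blast dest: PiE_mem PiE_mem funcset_mem)+
  have "Max ((\<lambda>l. \<bar>x l k - y l k\<bar>) ` {1..r}) \<le> \<rho> + (if k < K then 0 else 1)"
    using assms(1)
  proof (subst Max_le_iff, goal_cases)
    case 3
    have "\<bar>x l k - y l k\<bar> \<le> \<rho> + (if k < K then 0 else 1)" if "l \<in> {1..r}" for l
      using in01[OF that] close[OF that, of k] assms(4) by (auto simp: abs_le_iff)
    then show ?case by blast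
  qed auto
  then have "(1/2) ^ Suc k * Max ((\<lambda>l. \<bar>x l k - y l k\<bar>) ` {1..r})
    \<le> (1/2) ^ Suc k * (\<rho> + (if k < K then 0 else 1))"
    by (intro mult_left_mono) auto
  then show "(1/2) ^ Suc k * Max ((\<lambda>l. \<bar>x l k - y l k\<bar>) ` {1..r})
    \<le> (1/2) ^ Suc k * \<rho> + (if k < K then 0 else (1/2) ^ Suc k)"
    by (simp add: distrib_left split: if_splits)
qed

lemma sponge_dist_ge:
  assumes "1 \<le> r" "x \<in> cube_space r" "y \<in> cube_space r" "l \<in> {1..r}"
  shows "\<bar>x l 0 - y l 0\<bar> \<le> 2 * sponge_dist r x y"
proof -
  let ?M = "\<lambda>k. Max ((\<lambda>l. \<bar>x l k - y l k\<bar>) ` {1..r})"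
  have "\<bar>x l k - y l k\<bar> \<le> ?M k" for k using assms(4) by (intro Max_ge) auto
  then have M0: "0 \<le> ?M k" for k using order_trans[OF abs_ge_zero] by blast
  have "(\<Sum>k<1. (1/2) ^ Suc k * ?M k) \<le> sponge_dist r x y"
    using sponge_dist_sums[OF assms(1-3)] M0
    by (subst sums_unique[OF sponge_dist_sums[OF assms(1-3)]], intro sum_le_suminf)
      (auto simp: sums_iff)
  moreover have "\<bar>x l 0 - y l 0\<bar> \<le> ?M 0" using assms(4) by (intro Max_ge) auto
  ultimately show ?thesis by simp
qed

lemma funpow_sponge_shift: "l \<in> {1..r} \<Longrightarrow> (sponge_shift r ^^ n) x l k = x l (n + k)"
  by (induction n arbitrary: k) (auto simp: sponge_shift_def seq_shift_def)

context sponge_data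
begin

abbreviation X :: "(nat \<Rightarrow> nat \<Rightarrow> real) set" where "X \<equiv> sponge r m \<Omega>"

abbreviation seqs :: "(nat \<Rightarrow> nat \<Rightarrow> nat \<Rightarrow> nat) set" where "seqs \<equiv> {\<omega>. \<forall>k. \<omega> k \<in> \<Omega>}"

definition point :: "(nat \<Rightarrow> nat \<Rightarrow> nat \<Rightarrow> nat) \<Rightarrow> nat \<Rightarrow> nat \<Rightarrow> real" where
  "point \<omega> = (\<lambda>l\<in>{1..r}. apply_bcontfun (\<Sum>k. (1 / real (m l) ^ Suc k) *\<^sub>R linfty (\<lambda>n. \<omega> k n l)))"

lemma sponge_eq: "X = point ` seqs"
  by (auto simp: sponge_def point_def)

lemma point_bounds:
  assumes "\<omega> \<in> seqs" "l \<in> {1..r}"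
  shows "real (leading (m l) (\<lambda>k. \<omega> k n l) L) / real (m l) ^ L \<le> point \<omega> l n"
    "point \<omega> l n \<le> (real (leading (m l) (\<lambda>k. \<omega> k n l) L) + 1) / real (m l) ^ L"
proof -
  have u: "\<omega> k n l < m l" for k n using assms digit_less by auto
  have "(\<lambda>k. real (\<omega> k n l) / real (m l) ^ Suc k) sums point \<omega> l n"
    using sponge_series(2)[of "m l" "\<lambda>k n. \<omega> k n l" n] m_ge_2[OF assms(2)] u assms(2)
    by (simp add: point_def)
  from expansion_bounds[OF m_ge_2[OF assms(2)] u this]
  show "real (leading (m l) (\<lambda>k. \<omega> k n l) L) / real (m l) ^ L \<le> point \<omega> l n"
    "point \<omega> l n \<le> (real (leading (m l) (\<lambda>k. \<omega> k n l) L) + 1) / real (m l) ^ L" by blast+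
qed

lemma point_close:
  assumes "\<omega> \<in> seqs" "\<omega>' \<in> seqs" "l \<in> {1..r}" "\<And>k. k < L \<Longrightarrow> \<omega> k n l = \<omega>' k n l"
  shows "\<bar>point \<omega> l n - point \<omega>' l n\<bar> \<le> 1 / real (m l) ^ L"
proof -
  have "leading (m l) (\<lambda>k. \<omega> k n l) L = leading (m l) (\<lambda>k. \<omega>' k n l) L"
    by (rule leading_cong) (use assms(4) in auto)
  then show ?thesis
    using point_bounds[OF assms(1,3), of n L] point_bounds[OF assms(2,3), of n L]
    by (simp add: add_divide_distrib abs_le_iff)
qed

text \<open>
  The points lie in the closed intervals \<open>[p, p + 1]\<close> and \<open>[p', p' + 1]\<close> in units of
  \<open>1 / m l ^ L\<close>, where \<open>p\<close> and \<open>p'\<close> are the two integers, and have distance below 2 units. The bound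
  2 on the distance, rather than 1, is the factor lost in \<open>bowen_sponge_ge\<close>.
\<close>
lemma leading_close:
  assumes "\<omega> \<in> seqs" "\<omega>' \<in> seqs" "l \<in> {1..r}" "\<bar>point \<omega> l n - point \<omega>' l n\<bar> < 2 / real (m l) ^ L"
  shows "\<bar>int (leading (m l) (\<lambda>k. \<omega> k n l) L) - int (leading (m l) (\<lambda>k. \<omega>' k n l) L)\<bar> \<le> 2"
proof -
  define p where "p = leading (m l) (\<lambda>k. \<omega> k n l) L"
  define p' where "p' = leading (m l) (\<lambda>k. \<omega>' k n l) L"
  define M where "M = real (m l) ^ L"
  have M: "0 < M" using m_ge_2[OF assms(3)] by (simp add: M_def)
  have b: "real p / M \<le> point \<omega> l n" "point \<omega> l n \<le> (real p + 1) / M"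
    "real p' / M \<le> point \<omega>' l n" "point \<omega>' l n \<le> (real p' + 1) / M"
    using point_bounds[OF assms(1,3), of n L] point_bounds[OF assms(2,3), of n L]
    by (auto simp: p_def p'_def M_def)
  have "\<bar>point \<omega> l n - point \<omega>' l n\<bar> < 2 / M" using assms(4) by (simp add: M_def)
  then have "real p / M < (real p' + 1) / M + 2 / M" "real p' / M < (real p + 1) / M + 2 / M"
    using b by linarith+
  then have "real p < real p' + 3" "real p' < real p + 3"
    using M by (auto simp: divide_less_cancel simp flip: add_divide_distrib)
  then have "\<bar>int p - int p'\<bar> \<le> 2" by linarith
  then show ?thesis by (simp add: p_def p'_def)
qed

lemma sponge_cube: "x \<in> X \<Longrightarrow> x \<in> cube_space r"
  using sponge_subset_cube[OF _ subshift] m_ge_2 by auto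

sublocale sys: bounded_system X "sponge_dist r" "sponge_shift r"
proof -
  have inv: "sponge_shift r ` X \<subseteq> X"
    using sponge_shift_invariant[OF _ subshift] m_ge_2 by auto
  interpret c: Metric_space "cube_space r" "sponge_dist r" by (rule Metric_space_cube[OF r])
  interpret Metric_space X "sponge_dist r" by (rule c.subspace) (use sponge_cube in auto)
  show "bounded_system X (sponge_dist r) (sponge_shift r)"
  proof
    obtain x where "x \<in> \<Omega>" using \<Omega>_nonempty by auto
    then show "X \<noteq> {}" unfolding sponge_eq by auto
    show "sponge_dist r x y \<le> 1" if "x \<in> X" "y \<in> X" for x y
      using sponge_dist_le[OF r, of x y 0 0] sponge_cube that by auto
    show "sponge_shift r x \<in> X" if "x \<in> X" for x using inv that by auto
  qed
qed

abbreviation dN :: "nat \<Rightarrow> (nat \<Rightarrow> nat \<Rightarrow> real) \<Rightarrow> (nat \<Rightarrow> nat \<Rightarrow> real) \<Rightarrow> real" where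
  "dN \<equiv> bowen (sponge_shift r) (sponge_dist r)"

text \<open>
  The dynamical metric sees all coordinates, but those from \<open>N + K\<close> on carry weight at most
  \<open>(1/2) ^ K\<close> in each of the \<open>N\<close> shifted metrics. As \<open>K\<close> depends on the scale only, the additional
  \<open>K\<close> coordinates are harmless as \<open>N\<close> tends to infinity.
\<close>
lemma bowen_sponge_le:
  assumes xy: "x \<in> X" "y \<in> X" and N: "1 \<le> N" and \<rho>: "0 \<le> \<rho>"
    and close: "\<And>l n. l \<in> {1..r} \<Longrightarrow> n < N + K \<Longrightarrow> \<bar>x l n - y l n\<bar> \<le> \<rho>"
  shows "dN N x y \<le> \<rho> + (1/2) ^ K"
  unfolding sys.bowen_le_iff[OF N]
proof (intro allI impI sponge_dist_le[OF r])
  fix n l k assume "n < N" "l \<in> {1..r}" "k < K"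
  then show "\<bar>(sponge_shift r ^^ n) x l k - (sponge_shift r ^^ n) y l k\<bar> \<le> \<rho>"
    using close[of l "n + k"] by (simp add: funpow_sponge_shift)
qed (use xy \<rho> sponge_cube sys.funpow_invariant in auto)

text \<open>The factor 2 is the inverse of the weight of the first term in \<open>sponge_dist\<close>.\<close>
lemma bowen_sponge_ge:
  assumes xy: "x \<in> X" "y \<in> X" and n: "n < N" and l: "l \<in> {1..r}"
  shows "\<bar>x l n - y l n\<bar> \<le> 2 * dN N x y"
proof -
  have "\<bar>x l n - y l n\<bar> \<le> 2 * sponge_dist r ((sponge_shift r ^^ n) x) ((sponge_shift r ^^ n) y)"
    using sponge_dist_ge[OF r sponge_cube[OF sys.funpow_invariant[OF xy(1), of n]]
        sponge_cube[OF sys.funpow_invariant[OF xy(2), of n]] l] l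
    by (simp add: funpow_sponge_shift)
  also have "\<dots> \<le> 2 * dN N x y" using sys.bowen_ge[OF n, of x y] by simp
  finally show ?thesis .
qed

section \<open>Approximate squares\<close>

text \<open>
  Here \<open>L l\<close> is the number of digits resolved in coordinate \<open>l\<close>, decreasing in \<open>l\<close>. Then the
  coordinates with a visible \<open>k\<close>-th digit form the initial segment \<open>{1..width L k}\<close>.
\<close>
definition width :: "(nat \<Rightarrow> nat) \<Rightarrow> nat \<Rightarrow> nat" where
  "width L k = card {l \<in> {1..r}. k < L l}"

text \<open>
  The symbolic code of the approximate square around \<open>\<omega>\<close>. It is a sequence of words of the
  projected subshifts, which makes its possible values, and later their masses, a product over \<open>k\<close>.
\<close>
definition square :: "(nat \<Rightarrow> nat) \<Rightarrow> nat \<Rightarrow> (nat \<Rightarrow> nat \<Rightarrow> nat \<Rightarrow> nat) \<Rightarrow> nat \<Rightarrow> nat \<Rightarrow> nat \<Rightarrow> nat" where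
  "square L N \<omega> = (\<lambda>k\<in>{..<L 1}. word (width L k) N (\<omega> k))"

lemma width_le: "width L k \<le> r"
  unfolding width_def by (rule order_trans[OF card_mono[of "{1..r}"]]) auto

lemma width_set:
  assumes "antimono_on {1..r} L"
  shows "{l \<in> {1..r}. k < L l} = {1..width L k}"
proof (cases "{l \<in> {1..r}. k < L l} = {}")
  case False
  define A where "A = {l \<in> {1..r}. k < L l}"
  have fin: "finite A" "A \<noteq> {}" using False unfolding A_def by simp_all
  have mx: "Max A \<in> A" by (rule Max_in[OF fin])
  have A: "A = {1..Max A}"
  proof
    show "A \<subseteq> {1..Max A}" using fin by (auto simp: A_def)
    show "{1..Max A} \<subseteq> A"
    proof
      fix l assume "l \<in> {1..Max A}"
      moreover then have "L (Max A) \<le> L l"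
        using mx by (intro monotone_onD[OF assms]) (auto simp: A_def)
      ultimately show "l \<in> A" using mx by (auto simp: A_def)
    qed
  qed
  have "width L k = card A" unfolding width_def A_def ..
  also have "\<dots> = card {1..Max A}" by (rule arg_cong[OF A])
  finally have "width L k = Max A" by simp
  then show ?thesis using A unfolding A_def by simp
qed (simp add: width_def)

lemma less_L_iff:
  assumes "antimono_on {1..r} L" "l \<in> {1..r}"
  shows "k < L l \<longleftrightarrow> l \<le> width L k"
proof -
  have "l \<in> {l \<in> {1..r}. k < L l} \<longleftrightarrow> l \<in> {1..width L k}" unfolding width_set[OF assms(1)] ..
  then show ?thesis using assms(2) by simp
qed

lemma L_le_L1: "antimono_on {1..r} L \<Longrightarrow> l \<in> {1..r} \<Longrightarrow> L l \<le> L 1"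
  using monotone_onD[of "{1..r}" "(\<le>)" "(\<ge>)" L 1 l] r by simp

lemma square_eq_iff:
  assumes L: "antimono_on {1..r} L"
  shows "square L N \<omega> = square L N \<omega>' \<longleftrightarrow> (\<forall>l\<in>{1..r}. \<forall>k<L l. \<forall>n<N. \<omega> k n l = \<omega>' k n l)"
proof -
  have "square L N \<omega> = square L N \<omega>' \<longleftrightarrow> (\<forall>k<L 1. word (width L k) N (\<omega> k) = word (width L k) N (\<omega>' k))"
  proof
    assume eq: "square L N \<omega> = square L N \<omega>'"
    show "\<forall>k<L 1. word (width L k) N (\<omega> k) = word (width L k) N (\<omega>' k)"
    proof (intro allI impI)
      fix k assume "k < L 1"
      then show "word (width L k) N (\<omega> k) = word (width L k) N (\<omega>' k)"
        using fun_cong[OF eq, of k] by (simp add: square_def)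
    qed
  qed (simp add: square_def fun_eq_iff)
  also have "\<dots> \<longleftrightarrow> (\<forall>l\<in>{1..r}. \<forall>k<L l. \<forall>n<N. \<omega> k n l = \<omega>' k n l)"
    unfolding word_eq_iff
  proof safe
    fix l k n assume *: "\<forall>k<L 1. \<forall>n<N. \<forall>l\<in>{1..width L k}. \<omega> k n l = \<omega>' k n l"
      and l: "l \<in> {1..r}" "k < L l" "n < N"
    then have "k < L 1" using L_le_L1[OF L l(1)] by linarith
    moreover have "l \<in> {1..width L k}" using less_L_iff[OF L l(1)] l by auto
    ultimately show "\<omega> k n l = \<omega>' k n l" using * l by blast
  next
    fix l k n assume *: "\<forall>l\<in>{1..r}. \<forall>k<L l. \<forall>n<N. \<omega> k n l = \<omega>' k n l"
      and l: "l \<in> {1..width L k}" "n < N"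
    then have "l \<in> {1..r}" using width_le[of L k] by auto
    moreover then have "k < L l" using less_L_iff[OF L] l by auto
    ultimately show "\<omega> k n l = \<omega>' k n l" using * l by blast
  qed
  finally show ?thesis .
qed

text \<open>
  Summation by parts: \<open>a (width L k)\<close> telescopes into the increments of \<open>a\<close> over the \<open>l\<close> with
  \<open>k < L l\<close>, and each \<open>l\<close> occurs for \<open>L l\<close> values of \<open>k\<close>.
\<close>
lemma sum_width:
  fixes a :: "nat \<Rightarrow> real"
  assumes L: "antimono_on {1..r} L" and a: "a 0 = 0"
  shows "(\<Sum>k<L 1. a (width L k)) = (\<Sum>l=1..r. (a l - a (l - 1)) * real (L l))"
proof -
  have tel: "(\<Sum>l=1..n. a l - a (l - 1)) = a n" for n
    using sum_telescope''[of 0 n a] a by (simp add: atLeastSucAtMost_greaterThanAtMost)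
  have "(\<Sum>k<L 1. a (width L k)) = (\<Sum>k<L 1. \<Sum>l\<in>{l\<in>{1..r}. k < L l}. a l - a (l - 1))"
    unfolding width_set[OF L] tel ..
  also have "\<dots> = (\<Sum>k<L 1. \<Sum>l=1..r. if k < L l then a l - a (l - 1) else 0)"
    by (intro sum.cong refl sum.inter_filter) simp
  also have "\<dots> = (\<Sum>l=1..r. \<Sum>k<L 1. if k < L l then a l - a (l - 1) else 0)"
    by (rule sum.swap)
  also have "\<dots> = (\<Sum>l=1..r. (a l - a (l - 1)) * real (L l))"
  proof (intro sum.cong refl)
    fix l assume "l \<in> {1..r}"
    then have "{k \<in> {..<L 1}. k < L l} = {..<L l}" using L_le_L1[OF L] by fastforce
    then show "(\<Sum>k<L 1. if k < L l then a l - a (l - 1) else 0) = (a l - a (l - 1)) * real (L l)"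
      by (subst sum.inter_filter[symmetric]) auto
  qed
  finally show ?thesis .
qed

end

context sponge_data
begin

lemma finite_squares: "finite (square L N ` seqs)"
  and card_squares_prod: "card (square L N ` seqs) \<le> (\<Prod>k<L 1. card (proj_words (width L k) \<Omega> N))"
proof -
  let ?P = "\<Pi>\<^sub>E k\<in>{..<L 1}. proj_words (width L k) \<Omega> N"
  have sub: "square L N ` seqs \<subseteq> ?P" 
  proof (rule image_subsetI)
    fix \<omega> assume "\<omega> \<in> seqs"
    then show "square L N \<omega> \<in> ?P"
      unfolding square_def proj_words_eq by (intro restrict_PiE_iff[THEN iffD2] ballI imageI) simp
  qed
  have fin: "finite ?P" by (intro finite_PiE finite_proj_words width_le) simp
  show "finite (square L N ` seqs)" by (rule finite_subset[OF sub fin])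
  have "card (square L N ` seqs) \<le> card ?P" by (rule card_mono[OF fin sub])
  then show "card (square L N ` seqs) \<le> (\<Prod>k<L 1. card (proj_words (width L k) \<Omega> N))"
    by (simp add: card_PiE)
qed

lemma ln_card_squares:
  assumes L: "antimono_on {1..r} L"
  shows "ln (real (card (square L N ` seqs))) \<le> (\<Sum>l=1..r. (ln (C l N) - ln (C (l - 1) N)) * real (L l))"
proof -
  have Cp: "0 < C (width L k) N" for k using C_pos[OF width_le, of L k N] by linarith
  obtain x where "x \<in> \<Omega>" using \<Omega>_nonempty by blast
  then have "square L N (\<lambda>_. x) \<in> square L N ` seqs" by (intro imageI) simp
  then have "0 < card (square L N ` seqs)" using finite_squares[of L N] card_gt_0_iff by blast
  moreover have "real (card (square L N ` seqs)) \<le> (\<Prod>k<L 1. C (width L k) N)"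
    using of_nat_mono[OF card_squares_prod[of L N], where 'a = real] by simp
  ultimately have "ln (real (card (square L N ` seqs))) \<le> ln (\<Prod>k<L 1. C (width L k) N)"
    by (intro ln_mono) auto
  also have "\<dots> = (\<Sum>k<L 1. ln (C (width L k) N))"
    by (rule ln_prod) (use Cp in simp_all)
  also have "\<dots> = (\<Sum>l=1..r. (ln (C l N) - ln (C (l - 1) N)) * real (L l))"
    by (rule sum_width[OF L]) (simp add: C_0)
  finally show ?thesis .
qed

text \<open>The largest \<open>L\<close> with \<open>m l ^ L \<le> exp \<tau>\<close>, for \<open>\<tau> \<ge> 0\<close>.\<close>
definition depth :: "real \<Rightarrow> nat \<Rightarrow> nat" where
  "depth \<tau> l = nat \<lfloor>\<tau> / ln (real (m l))\<rfloor>"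

lemma ln_m: "l \<in> {1..r} \<Longrightarrow> ln 2 \<le> ln (real (m l))"
  using m_ge_2 by (intro ln_mono) auto

lemma ln_m_pos: "l \<in> {1..r} \<Longrightarrow> 0 < ln (real (m l))"
  using m_ge_2[of l] by simp

lemma depth_le: "0 \<le> \<tau> \<Longrightarrow> l \<in> {1..r} \<Longrightarrow> real (depth \<tau> l) \<le> \<tau> / ln (real (m l))"
  using ln_m_pos[of l] unfolding depth_def by simp

lemma depth_ge: "\<tau> / ln (real (m l)) - 1 \<le> real (depth \<tau> l)"
  unfolding depth_def by linarith

lemma depth_antimono: "0 \<le> \<tau> \<Longrightarrow> antimono_on {1..r} (depth \<tau>)"
proof (rule monotone_onI)
  fix l l' assume *: "0 \<le> \<tau>" "l \<in> {1..r}" "l' \<in> {1..r}" "l \<le> l'"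
  have "real (m l) \<le> real (m l')" using m_le[OF *(2-4)] by simp
  then have "ln (real (m l)) \<le> ln (real (m l'))" using m_ge_2[OF *(2)] by (intro ln_mono) auto
  then have "\<tau> / ln (real (m l')) \<le> \<tau> / ln (real (m l))"
    using *(1) ln_m_pos[OF *(2)] by (intro divide_left_mono) auto
  then show "depth \<tau> l' \<le> depth \<tau> l" unfolding depth_def by (intro nat_mono floor_mono)
qed

lemma cylinder_length_le:
  assumes "l \<in> {1..r}"
  shows "1 / real (m l) ^ depth \<tau> l \<le> real (m l) * exp (- \<tau>)"
proof -
  have m: "0 < real (m l)" using m_ge_2[OF assms] by simp
  have "\<tau> \<le> (real (depth \<tau> l) + 1) * ln (real (m l))"
    using depth_ge[of \<tau> l] ln_m_pos[OF assms] by (simp add: field_simps)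
  then have "exp \<tau> \<le> exp (real (Suc (depth \<tau> l)) * ln (real (m l)))" by (simp add: add.commute)
  also have "\<dots> = real (m l) ^ Suc (depth \<tau> l)" unfolding exp_of_nat_mult using m by simp
  finally show ?thesis using m by (simp add: exp_minus field_simps)
qed

lemma cylinder_length_ge:
  assumes "l \<in> {1..r}" "0 \<le> \<tau>"
  shows "exp (- \<tau>) \<le> 1 / real (m l) ^ depth \<tau> l"
proof -
  have m: "0 < real (m l)" using m_ge_2[OF assms(1)] by simp
  have "real (depth \<tau> l) * ln (real (m l)) \<le> \<tau>"
    using depth_le[OF assms(2,1)] ln_m_pos[OF assms(1)] by (simp add: field_simps)
  then have le: "exp (real (depth \<tau> l) * ln (real (m l))) \<le> exp \<tau>" by simp
  have "exp (real (depth \<tau> l) * ln (real (m l))) = real (m l) ^ depth \<tau> l"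
    unfolding exp_of_nat_mult using m by simp
  from ord_eq_le_trans[OF this[symmetric] le] have "real (m l) ^ depth \<tau> l \<le> exp \<tau>" .
  then show ?thesis using m by (simp add: exp_minus field_simps)
qed

text \<open>
  The counterpart of the dimension \<open>D\<close> for words of length \<open>N\<close>: the limit of \<open>exponent N / N\<close> is
  \<open>D\<close>.
\<close>
definition exponent :: "nat \<Rightarrow> real" where
  "exponent N = (\<Sum>l=1..r. (ln (C l N) - ln (C (l - 1) N)) / ln (real (m l)))"

lemma ln_C_diff_nonneg:
  assumes "l \<in> {1..r}"
  shows "0 \<le> ln (C l N) - ln (C (l - 1) N)"
proof -
  have l: "l - 1 \<le> l" "l \<le> r" "l - 1 \<le> r" using assms by auto
  have "0 < C (l - 1) N" using C_pos[OF l(3), of N] by linarith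
  then have "ln (C (l - 1) N) \<le> ln (C l N)" using C_mono[OF l(1,2), of N] by (intro ln_mono) simp_all
  then show ?thesis by simp
qed

lemma ln_card_squares_depth:
  assumes "0 \<le> \<tau>"
  shows "ln (real (card (square (depth \<tau>) N ` seqs))) \<le> \<tau> * exponent N"
proof -
  have "ln (real (card (square (depth \<tau>) N ` seqs)))
      \<le> (\<Sum>l=1..r. (ln (C l N) - ln (C (l - 1) N)) * real (depth \<tau> l))"
    by (rule ln_card_squares[OF depth_antimono[OF assms]])
  also have "\<dots> \<le> (\<Sum>l=1..r. (ln (C l N) - ln (C (l - 1) N)) * (\<tau> / ln (real (m l))))"
    by (intro sum_mono mult_left_mono depth_le[OF assms] ln_C_diff_nonneg)
  finally show ?thesis by (simp add: exponent_def sum_distrib_left mult.commute)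
qed

text \<open>
  Rounding down the depths costs at most 1 in each, in total \<open>ln (C r N) = O(N)\<close> by telescoping,
  whatever the scale.
\<close>
lemma sum_depth_ge:
  assumes "0 \<le> \<tau>"
  shows "\<tau> * exponent N - ln (C r N) \<le> (\<Sum>l=1..r. (ln (C l N) - ln (C (l - 1) N)) * real (depth \<tau> l))"
proof -
  have tel: "(\<Sum>l=1..r. ln (C l N) - ln (C (l - 1) N)) = ln (C r N)"
    using sum_telescope''[of 0 r "\<lambda>l. ln (C l N)"] by (simp add: atLeastSucAtMost_greaterThanAtMost C_0)
  have factor: "\<tau> * (c / x) - c = c * (\<tau> / x - 1)" for c x by (simp add: right_diff_distrib)
  have "\<tau> * exponent N - ln (C r N)
    = (\<Sum>l=1..r. (ln (C l N) - ln (C (l - 1) N)) * (\<tau> / ln (real (m l)) - 1))"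
    unfolding tel[symmetric] exponent_def sum_distrib_left sum_subtractf[symmetric]
    by (intro sum.cong refl factor)
  also have "\<dots> \<le> (\<Sum>l=1..r. (ln (C l N) - ln (C (l - 1) N)) * real (depth \<tau> l))"
    by (intro sum_mono mult_left_mono depth_ge ln_C_diff_nonneg)
  finally show ?thesis .
qed

lemma exponent_convergent:
  obtains D h where "(\<lambda>N. exponent N / real N) \<longlonglongrightarrow> D" "(\<lambda>N. ln (C r N) / real N) \<longlonglongrightarrow> h"
proof -
  have "\<forall>l\<in>{..r}. \<exists>h. (\<lambda>N. ln (C l N) / real N) \<longlonglongrightarrow> h" using C_entropy_exists by auto
  then obtain h where h: "\<And>l. l \<le> r \<Longrightarrow> (\<lambda>N. ln (C l N) / real N) \<longlonglongrightarrow> h l"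
    by (auto dest!: bchoice)
  have "(\<lambda>N. \<Sum>l=1..r. (ln (C l N) / real N - ln (C (l - 1) N) / real N) / ln (real (m l)))
      \<longlonglongrightarrow> (\<Sum>l=1..r. (h l - h (l - 1)) / ln (real (m l)))"
  proof (rule tendsto_sum)
    fix l assume l: "l \<in> {1..r}"
    then have "l \<le> r" "l - 1 \<le> r" by auto
    then show "(\<lambda>N. (ln (C l N) / real N - ln (C (l - 1) N) / real N) / ln (real (m l)))
        \<longlonglongrightarrow> (h l - h (l - 1)) / ln (real (m l))"
      using ln_m_pos[OF l] by (intro tendsto_divide tendsto_diff h tendsto_const) linarith+
  qed
  moreover have "(\<Sum>l=1..r. (ln (C l N) / real N - ln (C (l - 1) N) / real N) / ln (real (m l)))
      = exponent N / real N" for N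
    unfolding exponent_def sum_divide_distrib
    by (intro sum.cong refl) (simp add: diff_divide_distrib mult.commute)
  ultimately show ?thesis using that h by auto
qed

text \<open>
  Points with the same approximate square are at distance at most \<open>(m r + 1) * exp (-\<tau>)\<close>: the first
  summand is the largest length of a cylinder, the second one the contribution of the coordinates
  beyond \<open>N + K\<close>. The constant 5 exceeds the factor 4 that \<open>finite_open_cover_code\<close> loses.
\<close>
lemma finite_open_cover_squares:
  assumes N: "1 \<le> N" and \<epsilon>: "0 < \<epsilon>" and \<tau>: "\<tau> = ln (5 * (real (m r) + 1) / \<epsilon>)" "0 \<le> \<tau>"
    and K: "(1/2) ^ K \<le> exp (- \<tau>)"
  shows "finite_open_cover X (dN N) \<epsilon> (card (square (depth \<tau>) (N + K) ` seqs))"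
proof -
  interpret N: bounded_metric X "dN N" by (rule sys.bounded_metric_bowen[OF N])
  define \<rho> where "\<rho> = real (m r) * exp (- \<tau>)"
  have pos: "0 < 5 * (real (m r) + 1) / \<epsilon>" using \<epsilon> by (intro divide_pos_pos) auto
  have "exp (- \<tau>) = \<epsilon> / (5 * (real (m r) + 1))"
    unfolding \<tau>(1) exp_minus exp_ln[OF pos] by simp
  moreover have "0 < 5 * (real (m r) + 1)" by simp
  ultimately have sum: "\<rho> + exp (- \<tau>) = \<epsilon> / 5"
    unfolding \<rho>_def by (simp add: field_simps)
  have e: "0 < \<rho> + exp (- \<tau>)" "4 * (\<rho> + exp (- \<tau>)) < \<epsilon>" using \<epsilon> by (simp_all add: sum)
  show ?thesis
  proof (rule N.finite_open_cover_code[OF sponge_eq finite_squares e])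
    fix \<omega> \<omega>' assume w: "\<omega> \<in> seqs" "\<omega>' \<in> seqs" "square (depth \<tau>) (N + K) \<omega> = square (depth \<tau>) (N + K) \<omega>'"
    have "dN N (point \<omega>) (point \<omega>') \<le> \<rho> + (1/2) ^ K"
    proof (rule bowen_sponge_le[OF _ _ N])
      show "point \<omega> \<in> X" "point \<omega>' \<in> X" using w unfolding sponge_eq by blast+
      show "0 \<le> \<rho>" by (simp add: \<rho>_def)
      fix l n assume l: "l \<in> {1..r}" and n: "n < N + K"
      have "\<bar>point \<omega> l n - point \<omega>' l n\<bar> \<le> 1 / real (m l) ^ depth \<tau> l"
        using w(3) l n unfolding square_eq_iff[OF depth_antimono[OF \<tau>(2)]]
        by (intro point_close w(1,2) l) auto
      also have "\<dots> \<le> real (m l) * exp (- \<tau>)" by (rule cylinder_length_le[OF l])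
      also have "\<dots> \<le> \<rho>" using m_le[OF l, of r] l r by (simp add: \<rho>_def)
      finally show "\<bar>point \<omega> l n - point \<omega>' l n\<bar> \<le> \<rho>" .
    qed
    then show "dN N (point \<omega>) (point \<omega>') \<le> \<rho> + exp (- \<tau>)" using K by linarith
  qed
qed

text \<open>
  The square of \<open>\<omega>\<close> is determined by the \<open>N * r\<close> integers \<open>leading\<close>, one for each position and
  coordinate. For points of a set of diameter below the cylinder lengths each of them is within 2 of
  that of a fixed point, which leaves five values. The bound is exponential in \<open>N\<close> but independent of
  the scale.
\<close>
lemma card_squares_small_diam:
  assumes N: "1 \<le> N" and L: "antimono_on {1..r} L"
    and E: "E \<subseteq> X" "diam_on (dN N) E < \<rho>" and \<rho>: "\<And>l. l \<in> {1..r} \<Longrightarrow> \<rho> \<le> 1 / real (m l) ^ L l"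
    and S: "S \<subseteq> seqs" "point ` S \<subseteq> E"
  shows "card (square L N ` S) \<le> 5 ^ (N * r)"
proof (cases "S = {}")
  case False
  interpret N: bounded_metric X "dN N" by (rule sys.bounded_metric_bowen[OF N])
  obtain \<omega>0 where \<omega>0: "\<omega>0 \<in> S" using False by auto
  define f where "f \<omega> = (\<lambda>(n, l)\<in>{..<N} \<times> {1..r}. int (leading (m l) (\<lambda>k. \<omega> k n l) (L l)))" for \<omega>
  let ?P = "\<Pi>\<^sub>E p\<in>{..<N} \<times> {1..r}. {f \<omega>0 p - 2..f \<omega>0 p + 2}"
  have "f \<omega> \<in> ?P" if \<omega>: "\<omega> \<in> S" for \<omega>
  proof -
    have "\<bar>int (leading (m l) (\<lambda>k. \<omega> k n l) (L l)) - int (leading (m l) (\<lambda>k. \<omega>0 k n l) (L l))\<bar> \<le> 2"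
      if "n < N" "l \<in> {1..r}" for n l
    proof (rule leading_close)
      have pE: "point \<omega> \<in> E" "point \<omega>0 \<in> E" using S(2) \<omega> \<omega>0 by auto
      then have "\<bar>point \<omega> l n - point \<omega>0 l n\<bar> \<le> 2 * dN N (point \<omega>) (point \<omega>0)"
        using E(1) that by (intro bowen_sponge_ge) auto
      also have "\<dots> \<le> 2 * diam_on (dN N) E" using N.diam_on_ge[OF E(1) pE] by simp
      also have "\<dots> < 2 * \<rho>" using E(2) by simp
      also have "\<dots> \<le> 2 / real (m l) ^ L l" using \<rho>[OF that(2)] by simp
      finally show "\<bar>point \<omega> l n - point \<omega>0 l n\<bar> < 2 / real (m l) ^ L l" .
    qed (use that \<omega> \<omega>0 S(1) in auto)
    then show ?thesis by (auto simp: f_def abs_le_iff) (smt (verit))+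
  qed
  then have sub: "f ` S \<subseteq> ?P" by blast
  have fin: "finite ?P" by (intro finite_PiE) auto
  have "square L N \<omega> = square L N \<omega>'" if w: "\<omega> \<in> S" "\<omega>' \<in> S" "f \<omega> = f \<omega>'" for \<omega> \<omega>'
    unfolding square_eq_iff[OF L]
  proof (intro ballI allI impI)
    fix l k n assume l: "l \<in> {1..r}" "k < L l" "n < N"
    have "leading (m l) (\<lambda>k. \<omega> k n l) (L l) = leading (m l) (\<lambda>k. \<omega>' k n l) (L l)"
      using fun_cong[OF w(3), of "(n, l)"] l by (simp add: f_def)
    from leading_eqD[OF _ _ this l(2)] show "\<omega> k n l = \<omega>' k n l"
      using w S(1) digit_less[OF _ l(1)] by auto
  qed
  then have "square L N \<omega> = square L N (inv_into S f (f \<omega>))" if "\<omega> \<in> S" for \<omega>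
    using that by (metis f_inv_into_f imageI inv_into_into)
  then have "square L N ` S = (\<lambda>y. square L N (inv_into S f y)) ` f ` S"
    unfolding image_image by (intro image_cong) auto
  then have "card (square L N ` S) \<le> card (f ` S)"
    using finite_subset[OF sub fin] by (simp add: card_image_le)
  also have "\<dots> \<le> card ?P" by (rule card_mono[OF fin sub])
  also have "\<dots> = 5 ^ (N * r)" by (subst card_PiE) (auto simp: card_cartesian_product)
  finally show ?thesis .
qed simp

section \<open>The uniform measure on digit sequences\<close>

text \<open>
  The \<open>k\<close>-th factor chooses the first \<open>N\<close> terms of the digit sequence \<open>\<omega> k\<close>. The rest of
  \<open>\<omega> k\<close> is filled in by \<open>extend\<close> in an arbitrary way, as it has no influence on approximate squares.
\<close>
definition words_measure :: "nat \<Rightarrow> (nat \<Rightarrow> nat \<Rightarrow> nat \<Rightarrow> nat) measure" where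
  "words_measure N = (\<Pi>\<^sub>M k\<in>UNIV. uniform_count_measure (proj_words r \<Omega> N))"

definition extend :: "nat \<Rightarrow> (nat \<Rightarrow> nat \<Rightarrow> nat) \<Rightarrow> nat \<Rightarrow> nat \<Rightarrow> nat" where
  "extend N w = (SOME x. x \<in> \<Omega> \<and> word r N x = w)"

lemma extend:
  assumes "w \<in> proj_words r \<Omega> N"
  shows "extend N w \<in> \<Omega>" "word r N (extend N w) = w"
proof -
  have "\<exists>x. x \<in> \<Omega> \<and> word r N x = w" using assms by (auto simp: proj_words_eq)
  from someI_ex[OF this] show "extend N w \<in> \<Omega>" "word r N (extend N w) = w"
    by (simp_all add: extend_def)
qed

lemma space_words_measure: "w \<in> space (words_measure N) \<longleftrightarrow> (\<forall>k. w k \<in> proj_words r \<Omega> N)"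
  by (auto simp: words_measure_def space_PiM PiE_iff space_uniform_count_measure)

lemma prob_space_words_measure: "prob_space (words_measure N)"
proof -
  have "proj_words r \<Omega> N \<noteq> {}" using \<Omega>_nonempty by (simp add: proj_words_eq)
  then show ?thesis unfolding words_measure_def
    using finite_proj_words[of r N] by (intro prob_space_PiM prob_space_uniform_count_measure) auto
qed

lemma measure_cylinder:
  fixes i :: "nat \<Rightarrow> nat" and n N :: nat and c :: "nat \<Rightarrow> nat \<Rightarrow> nat \<Rightarrow> nat"
  defines "A \<equiv> {w \<in> space (words_measure N). \<forall>k\<in>{..<n}. w k \<in> words_over (i k) r N (c k)}"
  shows "A \<in> sets (words_measure N)"
    and "measure (words_measure N) A = (\<Prod>k<n. real (card (words_over (i k) r N (c k))) / C r N)"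
proof -
  let ?U = "\<lambda>k :: nat. uniform_count_measure (proj_words r \<Omega> N)"
  have ne: "proj_words r \<Omega> N \<noteq> {}" using \<Omega>_nonempty by (simp add: proj_words_eq)
  have fin: "finite (proj_words r \<Omega> N)" using finite_proj_words by simp
  have sub: "words_over (i k) r N (c k) \<subseteq> proj_words r \<Omega> N" for k by (auto simp: words_over_def)
  interpret U: prob_space "?U k" for k by (rule prob_space_uniform_count_measure[OF fin ne])
  interpret product_prob_space ?U UNIV ..
  interpret W: prob_space "words_measure N" by (rule prob_space_words_measure)
  have "A = prod_emb UNIV ?U {..<n} (\<Pi>\<^sub>E k\<in>{..<n}. words_over (i k) r N (c k))"
    unfolding A_def words_measure_def prod_emb_def by (auto simp: space_PiM Pi_iff)
  then show "A \<in> sets (words_measure N)"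
    unfolding words_measure_def using sub
    by (auto intro!: sets_PiM_I simp: sets_uniform_count_measure)
  have "emeasure (words_measure N) A = (\<Prod>k<n. emeasure (?U k) (words_over (i k) r N (c k)))"
    unfolding A_def words_measure_def using sub
    by (intro emeasure_PiM_Collect) (auto simp: sets_uniform_count_measure)
  also have "\<dots> = (\<Prod>k<n. ennreal (real (card (words_over (i k) r N (c k))) / C r N))"
    using emeasure_uniform_count_measure[OF fin sub] by simp
  also have "\<dots> = ennreal (\<Prod>k<n. real (card (words_over (i k) r N (c k))) / C r N)"
    by (rule prod_ennreal) simp
  finally show "measure (words_measure N) A = (\<Prod>k<n. real (card (words_over (i k) r N (c k))) / C r N)"
    by (simp add: measure_def prod_nonneg)
qed

text \<open>
  A set of diameter below \<open>\<rho> = exp (-\<tau>)\<close> is covered by at most \<open>5 ^ (N * r)\<close> cylinders, one for each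
  approximate square that it meets. The mass of a cylinder is the product over the digit index \<open>k\<close> of
  the masses of projected words, each of which is \<open>exp (N * \<delta>) / C (width L k) N\<close> at most. The
  product of the denominators is about \<open>exp (\<tau> * exponent N)\<close>, and the number of factors is at most
  \<open>\<tau> / ln 2 \<le> 2 * \<tau>\<close>, whence the loss \<open>2 * \<delta>\<close> in the exponent.
\<close>
lemma frostman_words:
  assumes N: "1 \<le> N" and \<delta>: "0 \<le> \<delta>"
    and unif: "\<And>i v. i \<in> {1..r} \<Longrightarrow> v \<in> proj_words i \<Omega> N \<Longrightarrow>
      real (card (words_over i r N v)) * C i N \<le> exp (real N * \<delta>) * C r N"
    and D: "real N * D \<le> exponent N" and h: "ln (C r N) \<le> real N * h"
  shows "frostman X (dN N) (words_measure N) (\<lambda>w. point (\<lambda>k. extend N (w k)))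
           (exp (real N * (real r * ln 5 + h))) (real N * (D - 2 * \<delta>))"
  unfolding frostman_def
proof (intro conjI allI impI)
  interpret W: prob_space "words_measure N" by (rule prob_space_words_measure)
  define e where "e w = (\<lambda>k. extend N (w k))" for w :: "nat \<Rightarrow> nat \<Rightarrow> nat \<Rightarrow> nat"
  have e: "e w \<in> seqs" if "w \<in> space (words_measure N)" for w
    using that extend(1) by (auto simp: e_def space_words_measure)
  show "prob_space (words_measure N)" by (rule prob_space_words_measure)
  show "(\<lambda>w. point (\<lambda>k. extend N (w k))) ` space (words_measure N) \<subseteq> X"
    using e unfolding sponge_eq e_def by blast
  fix \<rho> E assume \<rho>: "0 < \<rho>" "\<rho> \<le> (1 :: real)" and E: "E \<subseteq> X" "diam_on (dN N) E < \<rho>"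
  define \<tau> where "\<tau> = ln (1 / \<rho>)"
  have \<tau>: "0 \<le> \<tau>" "\<rho> = exp (- \<tau>)" using \<rho> by (auto simp: \<tau>_def ln_div)
  define L where "L = depth \<tau>"
  have L: "antimono_on {1..r} L" unfolding L_def by (rule depth_antimono[OF \<tau>(1)])
  define V where "V = {w \<in> space (words_measure N). point (e w) \<in> E}"
  define Q where "Q = square L N ` e ` V"
  define cyl where "cyl c = {w \<in> space (words_measure N).
    \<forall>k\<in>{..<L 1}. w k \<in> words_over (width L k) r N (c k)}" for c
  have eV: "e ` V \<subseteq> seqs" using e by (auto simp: V_def)
  have Q: "finite Q" "card Q \<le> 5 ^ (N * r)"
  proof -
    show "finite Q" unfolding Q_def by (rule finite_subset[OF image_mono[OF eV] finite_squares])
    show "card Q \<le> 5 ^ (N * r)"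
      unfolding Q_def
    proof (rule card_squares_small_diam[OF N L E _ eV])
      show "\<rho> \<le> 1 / real (m l) ^ L l" if "l \<in> {1..r}" for l
        unfolding \<tau>(2) L_def by (rule cylinder_length_ge[OF that \<tau>(1)])
    qed (auto simp: V_def)
  qed
  have cyl: "measure (words_measure N) (cyl c) \<le> exp (real N * (2 * \<delta> * \<tau> - D * \<tau> + h))" if c: "c \<in> Q" for c
  proof -
    have "measure (words_measure N) (cyl c) = (\<Prod>k<L 1. real (card (words_over (width L k) r N (c k))) / C r N)"
      unfolding cyl_def by (rule measure_cylinder)
    also have "\<dots> \<le> (\<Prod>k<L 1. exp (real N * \<delta> - ln (C (width L k) N)))"
    proof (rule prod_mono, intro conjI)
      fix k assume k: "k \<in> {..<L 1}"
      then have w: "width L k \<in> {1..r}" using less_L_iff[OF L, of 1 k] r width_le[of L k] by auto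
      have "c k \<in> proj_words (width L k) \<Omega> N"
        using c k eV unfolding Q_def square_def proj_words_eq by auto
      from unif[OF w this] have "real (card (words_over (width L k) r N (c k))) / C r N \<le> exp (real N * \<delta>) / C (width L k) N"
        using C_pos[of r N] C_pos[OF width_le, of L k N] by (simp add: field_simps)
      also have "\<dots> = exp (real N * \<delta> - ln (C (width L k) N))"
        unfolding exp_diff using C_pos[OF width_le, of L k N] by simp
      finally show "real (card (words_over (width L k) r N (c k))) / C r N \<le> exp (real N * \<delta> - ln (C (width L k) N))" .
    qed simp
    also have "\<dots> = exp (\<Sum>k<L 1. real N * \<delta> - ln (C (width L k) N))" by (simp add: exp_sum)
    also have "\<dots> \<le> exp (real N * (2 * \<delta> * \<tau> - D * \<tau> + h))"
    proof -
      have "(\<Sum>k<L 1. real N * \<delta> - ln (C (width L k) N))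
        = real N * \<delta> * real (L 1) - (\<Sum>l=1..r. (ln (C l N) - ln (C (l - 1) N)) * real (L l))"
        using sum_width[OF L, of "\<lambda>i. ln (C i N)"] by (simp add: sum_subtractf C_0)
      also have "\<dots> \<le> real N * \<delta> * (2 * \<tau>) - (\<tau> * (real N * D) - real N * h)"
      proof (rule diff_mono)
        have "real (L 1) \<le> \<tau> / ln (real (m 1))" unfolding L_def using r by (intro depth_le \<tau>) auto
        also have "\<dots> \<le> \<tau> / (1 / 2)"
          using ln_m[of 1] r \<tau>(1) ln2_ge_two_thirds by (intro divide_left_mono) auto
        finally show "real N * \<delta> * real (L 1) \<le> real N * \<delta> * (2 * \<tau>)"
          using \<delta> by (intro mult_left_mono) auto
        have "\<tau> * (real N * D) - real N * h \<le> \<tau> * exponent N - ln (C r N)"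
          using D h \<tau>(1) by (intro diff_mono mult_left_mono) auto
        also note sum_depth_ge[OF \<tau>(1), of N]
        finally show "\<tau> * (real N * D) - real N * h
            \<le> (\<Sum>l=1..r. (ln (C l N) - ln (C (l - 1) N)) * real (L l))" by (simp add: L_def)
      qed
      finally show ?thesis by (simp add: algebra_simps)
    qed
    finally show ?thesis .
  qed
  show "\<exists>A\<in>sets (words_measure N). {w \<in> space (words_measure N). point (\<lambda>k. extend N (w k)) \<in> E} \<subseteq> A \<and>
      measure (words_measure N) A \<le> exp (real N * (real r * ln 5 + h)) * \<rho> powr (real N * (D - 2 * \<delta>))"
  proof (intro bexI conjI)
    show "(\<Union>c\<in>Q. cyl c) \<in> sets (words_measure N)"
      unfolding cyl_def using Q(1) measure_cylinder(1) by (intro sets.finite_UN) auto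
    show "{w \<in> space (words_measure N). point (\<lambda>k. extend N (w k)) \<in> E} \<subseteq> (\<Union>c\<in>Q. cyl c)"
    proof
      fix w assume w: "w \<in> {w \<in> space (words_measure N). point (\<lambda>k. extend N (w k)) \<in> E}"
      have "w k \<in> words_over (width L k) r N (square L N (e w) k)" if "k < L 1" for k
      proof -
        have wk: "w k \<in> proj_words r \<Omega> N" using w by (simp add: space_words_measure)
        have "word (width L k) N (e w k) = project_word (width L k) N (w k)"
          using project_word_word[OF width_le[of L k], of N "e w k"] extend(2)[OF wk] by (simp add: e_def)
        then show ?thesis using wk that by (simp add: words_over_def square_def)
      qed
      then have "w \<in> cyl (square L N (e w))" using w by (auto simp: cyl_def)
      moreover have "square L N (e w) \<in> Q" using w by (auto simp: Q_def V_def e_def)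
      ultimately show "w \<in> (\<Union>c\<in>Q. cyl c)" by blast
    qed
    have "measure (words_measure N) (\<Union>c\<in>Q. cyl c) \<le> (\<Sum>c\<in>Q. measure (words_measure N) (cyl c))"
      using Q(1) measure_cylinder(1) unfolding cyl_def by (intro W.finite_measure_subadditive_finite) auto
    also have "\<dots> \<le> real (card Q) * exp (real N * (2 * \<delta> * \<tau> - D * \<tau> + h))"
      using sum_bounded_above[of Q, OF cyl] by simp
    also have "\<dots> \<le> 5 ^ (N * r) * exp (real N * (2 * \<delta> * \<tau> - D * \<tau> + h))"
    proof (rule mult_right_mono)
      show "real (card Q) \<le> 5 ^ (N * r)" using of_nat_mono[OF Q(2), where 'a = real] by simp
    qed simp
    also have "(5 :: real) ^ (N * r) = exp (real N * (real r * ln 5))"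
    proof -
      have "exp (real (N * r) * ln (5 :: real)) = exp (ln 5) ^ (N * r)" by (rule exp_of_nat_mult)
      then show ?thesis by (simp add: mult.assoc)
    qed
    also have "exp (real N * (real r * ln 5)) * exp (real N * (2 * \<delta> * \<tau> - D * \<tau> + h))
      = exp (real N * (real r * ln 5 + h)) * \<rho> powr (real N * (D - 2 * \<delta>))"
      unfolding \<tau>(2) powr_def by (simp add: algebra_simps flip: exp_add)
    finally show "measure (words_measure N) (\<Union>c\<in>Q. cyl c)
      \<le> exp (real N * (real r * ln 5 + h)) * \<rho> powr (real N * (D - 2 * \<delta>))" .
  qed
qed

section \<open>Equality of the mean dimensions\<close>
theorem mean_dimensions_sponge:
  assumes unif: uniform_fibers
  shows "\<exists>D. lower_mdim_H X (sponge_shift r) (sponge_dist r) = ereal D \<and>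
    upper_mdim_H X (sponge_shift r) (sponge_dist r) = ereal D \<and>
    lower_mdim_M X (sponge_shift r) (sponge_dist r) = ereal D \<and>
    upper_mdim_M X (sponge_shift r) (sponge_dist r) = ereal D"
proof -
  obtain D h where D: "(\<lambda>N. exponent N / real N) \<longlonglongrightarrow> D" and h: "(\<lambda>N. ln (C r N) / real N) \<longlonglongrightarrow> h"
    by (rule exponent_convergent)
  define B where "B = 5 * (real (m r) + 1)"
  have B: "1 \<le> B" by (simp add: B_def)
  have K: "\<exists>K. (1/2 :: real) ^ K \<le> exp (- \<tau>)" for \<tau>
    using real_arch_pow_inv[of "exp (- \<tau>)" "1/2"] by (auto intro: less_imp_le)
  show ?thesis
  proof (intro exI[of _ D] sys.mean_dimensions_eq[OF _ B])
    fix N :: nat and \<epsilon> :: real assume N: "1 \<le> N" and \<epsilon>: "0 < \<epsilon>"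
    define \<epsilon>' where "\<epsilon>' = min \<epsilon> 1"
    have \<epsilon>': "0 < \<epsilon>'" "\<epsilon>' \<le> 1" "\<epsilon>' \<le> \<epsilon>" using \<epsilon> by (auto simp: \<epsilon>'_def)
    define \<tau> where "\<tau> = ln (B / \<epsilon>')"
    have \<tau>: "0 \<le> \<tau>" using B \<epsilon>' by (simp add: \<tau>_def)
    obtain K where K: "(1/2 :: real) ^ K \<le> exp (- \<tau>)" using K by blast
    have "finite_open_cover X (dN N) \<epsilon>' (card (square (depth \<tau>) (N + K) ` seqs))"
      using finite_open_cover_squares[OF N \<epsilon>'(1) _ \<tau> K] by (simp add: \<tau>_def B_def)
    then show "\<exists>n. finite_open_cover X (dN N) \<epsilon> n"
      unfolding finite_open_cover_def using \<epsilon>'(3) by (meson less_le_trans)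
  next
    fix \<epsilon> \<delta> :: real assume \<epsilon>: "0 < \<epsilon>" "\<epsilon> < 1" and \<delta>: "0 < \<delta>"
    define \<tau> where "\<tau> = ln (B / \<epsilon>)"
    have \<tau>: "0 \<le> \<tau>" using B \<epsilon> by (simp add: \<tau>_def)
    obtain K where K: "(1/2 :: real) ^ K \<le> exp (- \<tau>)" using K by blast
    have "(\<lambda>N. (1 + real K / real N) * (exponent (N + K) / real (N + K))) \<longlonglongrightarrow> (1 + 0) * D"
      by (intro tendsto_mult tendsto_add tendsto_const lim_const_over_n LIMSEQ_ignore_initial_segment[OF D])
    then have "\<forall>\<^sub>F N in sequentially. (1 + real K / real N) * (exponent (N + K) / real (N + K)) < D + \<delta>"
      using \<delta> by (intro order_tendstoD(2)) auto
    then show "\<forall>\<^sub>F N in sequentially. ln (real (cover_num X (dN N) \<epsilon>)) \<le> real N * ((D + \<delta>) * ln (B / \<epsilon>))"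
      using eventually_ge_at_top[of 1]
    proof eventually_elim
      case (elim N)
      interpret N: bounded_metric X "dN N" by (rule sys.bounded_metric_bowen) (use elim in simp)
      have fc: "finite_open_cover X (dN N) \<epsilon> (card (square (depth \<tau>) (N + K) ` seqs))"
        using finite_open_cover_squares[OF elim(2) \<epsilon>(1) _ \<tau> K] by (simp add: \<tau>_def B_def)
      have "1 \<le> cover_num X (dN N) \<epsilon>"
        using finite_open_cover_cover_num[OF fc] by (simp add: finite_open_cover_def)
      then have "ln (real (cover_num X (dN N) \<epsilon>)) \<le> ln (real (card (square (depth \<tau>) (N + K) ` seqs)))"
        using cover_num_le[OF fc] by (intro ln_mono) auto
      also have "\<dots> \<le> \<tau> * exponent (N + K)" by (rule ln_card_squares_depth[OF \<tau>])
      also have "\<dots> = \<tau> * (real N * ((1 + real K / real N) * (exponent (N + K) / real (N + K))))"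
      proof -
        have "real N * (1 + real K / real N) = real (N + K)" using elim(2) by (simp add: field_simps)
        then have "real N * ((1 + real K / real N) * (exponent (N + K) / real (N + K)))
            = real (N + K) * (exponent (N + K) / real (N + K))" by (simp only: mult.assoc[symmetric])
        then show ?thesis using elim(2) by simp
      qed
      also have "\<dots> \<le> \<tau> * (real N * (D + \<delta>))"
        using elim \<tau> by (intro mult_left_mono) auto
      finally show ?case by (simp add: \<tau>_def mult_ac)
    qed
  next
    fix \<delta> :: real assume \<delta>: "0 < \<delta>"
    have "\<forall>\<^sub>F N in sequentially. \<forall>i\<in>{1..r}. \<forall>v\<in>proj_words i \<Omega> N.
        real (card (words_over i r N v)) * C i N \<le> exp (real N * (\<delta> / 4)) * C r N"
    proof (intro eventually_ball_finite ballI)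
      fix i assume "i \<in> {1..r}"
      then show "\<forall>\<^sub>F N in sequentially. \<forall>v\<in>proj_words i \<Omega> N.
          real (card (words_over i r N v)) * C i N \<le> exp (real N * (\<delta> / 4)) * C r N"
        by (intro eventually_card_words_over[OF unif]) (use \<delta> in auto)
    qed simp
    moreover have "\<forall>\<^sub>F N in sequentially. D - \<delta> / 2 < exponent N / real N"
      using \<delta> by (intro order_tendstoD(1)[OF D]) simp
    moreover have "\<forall>\<^sub>F N in sequentially. ln (C r N) / real N < h + 1"
      by (intro order_tendstoD(2)[OF h]) simp
    ultimately show "\<forall>\<^sub>F N in sequentially. \<exists>(M :: (nat \<Rightarrow> nat \<Rightarrow> nat \<Rightarrow> nat) measure) \<Phi>. 
        frostman X (dN N) M \<Phi> (exp (real N * (real r * ln 5 + (h + 1)))) (real N * (D - \<delta>))"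
      using eventually_ge_at_top[of 1]
    proof eventually_elim
      case (elim N)
      have "frostman X (dN N) (words_measure N) (\<lambda>w. point (\<lambda>k. extend N (w k)))
           (exp (real N * (real r * ln 5 + (h + 1)))) (real N * (D - \<delta> / 2 - 2 * (\<delta> / 4)))"
      proof (rule frostman_words)
        show "real N * (D - \<delta> / 2) \<le> exponent N" "ln (C r N) \<le> real N * (h + 1)"
          using elim by (auto simp: field_simps)
      qed (use elim \<delta> in auto)
      then show ?case by auto
    qed
  qed
qed

end

theorem lemma3p4:
  fixes r :: nat and m :: "nat \<Rightarrow> nat" and \<Omega> :: "(nat \<Rightarrow> nat \<Rightarrow> nat) set"
  assumes "1 \<le> r" and "2 \<le> m 1" and "mono_on {1..r} m"
    and "subshift (alphabet m r) \<Omega>" and "\<Omega> \<noteq> {}"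
    and "\<forall>i\<in>{1..r - 1}. \<exists>P :: nat \<Rightarrow> real. (\<forall>N\<ge>1. 0 < P N) \<and>
           (\<forall>e>0. \<forall>\<^sub>F N in sequentially. \<forall>v\<in>proj_words (r - i) \<Omega> N.
              \<bar>root N (real (card (tau_fiber r \<Omega> i N v)) / P N) - 1\<bar> < e)"
  shows "lower_mdim_H (sponge r m \<Omega>) (sponge_shift r) (sponge_dist r)
           = upper_mdim_H (sponge r m \<Omega>) (sponge_shift r) (sponge_dist r) \<and>
         lower_mdim_M (sponge r m \<Omega>) (sponge_shift r) (sponge_dist r)
           = upper_mdim_M (sponge r m \<Omega>) (sponge_shift r) (sponge_dist r) \<and>
         upper_mdim_H (sponge r m \<Omega>) (sponge_shift r) (sponge_dist r)
           = upper_mdim_M (sponge r m \<Omega>) (sponge_shift r) (sponge_dist r)"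
proof -
  interpret sponge_data r m \<Omega> by unfold_locales (use assms in auto)
  have uniform_fibers unfolding uniform_fibers_def by (rule assms(6))
  from mean_dimensions_sponge[OF this] show ?thesis by auto
qed

end
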